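(* Let $\phi$ be a smooth real scalar field on Minkowski space, let $\zeta$ be a real constant, and let $\theta_\alpha=U_\alpha:=\phi\,(\cos\zeta+i\sin\zeta\,\mathcal J)\Theta_\alpha$. Then $$L_V=-96\cos 2\zeta\,\bigl[(\partial^\alpha\phi)(\partial_\alpha\phi)+8\cos2\zeta\,\phi^4\bigr].$$ If $\tau\neq0$ is a real constant and $\cos2\zeta\ne0$, then the field equation obtained by varying $L=L_K-\tau L_V$ with respect to $\phi$ is $$\partial_\alpha\partial^\alpha\phi-16\cos2\zeta\,\phi^3=\frac{1}{192\,\tau\cos2\zeta}\,\psi^\dagger\hat\eta\gamma^\alpha(\cos\zeta+i\sin\zeta\,\mathcal J)\Theta_\alpha\psi .$$
   Context: Minkowski space is $\mathbb R^4$ with coordinates $x^\alpha$ and constant metric $\eta=\mathrm{diag}(1,-1,-1,-1)$; indices are raised and lowered with $\eta$, and repeated indices are summed. The complex exterior algebra $\bigwedge_*$ of $\mathbb R^4$ has basis $\mathbf e_I=\mathbf e_{\alpha_1}\wedge\cdots\wedge\mathbf e_{\alpha_k}$, $\alpha_1<\dots<\alpha_k$, $|I|=k$ ($\mathbf e_\emptyset=1$); $16\times16$ matrices are operators on it in this basis and $\dagger$ is conjugate transpose. Gamma matrices: $\gamma_\alpha\psi=\mathbf e_\alpha\wedge\psi-\iota_\alpha\psi$, where $\iota_\alpha$ is the linear operator with $\iota_\alpha\mathbf e_\emptyset=0$, $\iota_\alpha\mathbf e_\beta=\eta_{\alpha\beta}\mathbf e_\emptyset$, $\iota_\alpha(\mathbf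 e_I\wedge\mathbf e_J)=(\iota_\alpha\mathbf e_I)\wedge\mathbf e_J+(-1)^{|I|}\mathbf e_I\wedge\iota_\alpha\mathbf e_J$. Extended metric: $\hat\eta_{IJ}=0$ if $|I|\ne|J|$, and $\hat\eta_{IJ}=\det(\eta_{\alpha_i\beta_j})$ if $I=\alpha_1\cdots\alpha_k$, $J=\beta_1\cdots\beta_k$. $\Theta_I$ is the $16\times16$ matrix that commutes with all gamma matrices and satisfies $\Theta_I\mathbf e_\emptyset=\mathbf e_I$; $\mathcal J=\Theta_{0123}$ (scalars stand for multiples of the identity). Given four matrix-valued fields $\theta_\alpha$, put $\Omega_{\alpha\beta}=\partial_\alpha\theta_\beta-\partial_\beta\theta_\alpha+\theta_\alpha\theta_\beta-\theta_\beta\theta_\alpha$ and $$L_V=\tfrac12\,\mathrm{tr}(\Omega_{\alpha\beta}\Omega^{\alpha\beta})+c.c.$$ For a smooth field $\psi:\mathbb R^4\to\bigwedge_*\cong\mathbb C^{16}$ and a real constant $m$, put $D\psi=\gamma^\alpha(\partial_\alpha\psi+\theta_\alpha\psi)$ and $$L_K=\tfrac12\psi^\dagger\hat\eta D\psi+c.c.-m\,\psi^\dagger\hat\eta\psi ,$$ where $c.c.$ is the complex conjugate of the preceding term. "The field equation obtained by varying $L$" with respect to a field means its Euler–Lagrange equation (stationarity of $\int L\,d^4x$ under compactly supported variations of that field, with $\psi$ fixed). *)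

theory Defs
  imports "HOL-Analysis.Analysis"
begin

text \<open>
  Spacetime indices are elements of the type \<^typ>\<open>4\<close>, i.e. 0, 1, 2, 3 with 4 = 0, in their usual
  order.  A basis element of the exterior algebra is indexed by the set of spacetime indices
  occurring in it; there are 16 such sets.
\<close>

type_synonym spacetime = "real ^ 4"
type_synonym multivector = "complex ^ (4 set)"
type_synonym multiop = "complex ^ (4 set) ^ (4 set)"


section \<open>Exterior algebra, gamma matrices and extended metric\<close>

definition eta :: "real ^ 4 ^ 4" where
  "eta = (\<chi> \<alpha> \<beta>. if \<alpha> = \<beta> then (if \<alpha> = 0 then 1 else -1) else 0)"

lemma eta_inverse: "eta ** eta = mat 1"
proof -
  have "(\<Sum>k\<in>UNIV. eta $ i $ k * eta $ k $ j) = (if i = j then 1 else 0)" for i j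
  proof -
    have "(\<Sum>k\<in>UNIV. eta $ i $ k * eta $ k $ j) = (\<Sum>k\<in>UNIV. if k = i then eta $ i $ i * eta $ i $ j else 0)"
      by (rule sum.cong) (auto simp: eta_def)
    then show ?thesis by (simp add: eta_def)
  qed
  then show ?thesis
    by (simp add: matrix_matrix_mult_def mat_def vec_eq_iff)
qed

definition eb :: "4 set \<Rightarrow> multivector" where
  "eb I = axis I 1"

definition shuffle_sign :: "4 set \<Rightarrow> 4 set \<Rightarrow> complex" where
  "shuffle_sign I J = (-1) ^ card {(i, j). i \<in> I \<and> j \<in> J \<and> j < i}"

text \<open>The bilinear product for which \<^term>\<open>eb I\<close> is the wedge product of the \<^term>\<open>eb {i}\<close>, taken in increasing
  order of the elements of \<^term>\<open>I\<close>.\<close>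

definition wedge :: "multivector \<Rightarrow> multivector \<Rightarrow> multivector" where
  "wedge u v = (\<chi> K. \<Sum>I\<in>Pow K. shuffle_sign I (K - I) * u $ I * v $ (K - I))"

definition is_iota :: "4 \<Rightarrow> multiop \<Rightarrow> bool" where
  "is_iota \<alpha> A \<longleftrightarrow>
     A *v eb {} = 0 \<and>
     (\<forall>\<beta>. A *v eb {\<beta>} = complex_of_real (eta $ \<alpha> $ \<beta>) *s eb {}) \<and>
     (\<forall>I J. A *v wedge (eb I) (eb J) = wedge (A *v eb I) (eb J) + (-1) ^ card I *s wedge (eb I) (A *v eb J))"

definition iota :: "4 \<Rightarrow> multiop" where
  "iota \<alpha> = (THE A. is_iota \<alpha> A)"

definition gamma :: "4 \<Rightarrow> multiop" where
  "gamma \<alpha> = matrix (\<lambda>\<psi>. wedge (eb {\<alpha>}) \<psi> - iota \<alpha> *v \<psi>)"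

definition gamma_up :: "4 \<Rightarrow> multiop" where
  "gamma_up \<alpha> = (\<Sum>\<beta>\<in>UNIV. eta $ \<alpha> $ \<beta> *\<^sub>R gamma \<beta>)"

text \<open>The minor determinant is written out by the Leibniz formula because its size depends on \<^term>\<open>I\<close>.\<close>

definition etahat :: multiop where
  "etahat = (\<chi> I J. if card I \<noteq> card J then 0 else
     complex_of_real (\<Sum>p | p permutes {..<card I}. of_int (sign p) *
       (\<Prod>i<card I. eta $ (sorted_list_of_set I ! i) $ (sorted_list_of_set J ! p i))))"

definition is_Theta :: "4 set \<Rightarrow> multiop \<Rightarrow> bool" where
  "is_Theta I A \<longleftrightarrow> (\<forall>\<alpha>. A ** gamma \<alpha> = gamma \<alpha> ** A) \<and> A *v eb {} = eb I"

definition Theta :: "4 set \<Rightarrow> multiop" where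
  "Theta I = (THE A. is_Theta I A)"

definition J_op :: multiop where
  "J_op = Theta {0, 1, 2, 3}"


section \<open>Fields and Lagrangians\<close>

definition pd :: "4 \<Rightarrow> (spacetime \<Rightarrow> 'b::real_normed_vector) \<Rightarrow> spacetime \<Rightarrow> 'b" where
  "pd \<alpha> f x = frechet_derivative f (at x) (axis \<alpha> 1)"

definition pd_up :: "4 \<Rightarrow> (spacetime \<Rightarrow> 'b::real_normed_vector) \<Rightarrow> spacetime \<Rightarrow> 'b" where
  "pd_up \<alpha> f x = (\<Sum>\<beta>\<in>UNIV. eta $ \<alpha> $ \<beta> *\<^sub>R pd \<beta> f x)"

primrec Ck :: "nat \<Rightarrow> (spacetime \<Rightarrow> 'b::real_normed_vector) \<Rightarrow> bool" where
  "Ck 0 f \<longleftrightarrow> continuous_on UNIV f"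
| "Ck (Suc k) f \<longleftrightarrow> f differentiable_on UNIV \<and> (\<forall>\<alpha>. Ck k (pd \<alpha> f))"

definition smooth :: "(spacetime \<Rightarrow> 'b::real_normed_vector) \<Rightarrow> bool" where
  "smooth f \<longleftrightarrow> (\<forall>k. Ck k f)"

definition plus_cc :: "complex \<Rightarrow> complex" where
  "plus_cc z = z + cnj z"

definition dagger_mult :: "multivector \<Rightarrow> multivector \<Rightarrow> complex" where
  "dagger_mult u v = (\<Sum>I\<in>UNIV. cnj (u $ I) * v $ I)"

definition Omega :: "(4 \<Rightarrow> spacetime \<Rightarrow> multiop) \<Rightarrow> 4 \<Rightarrow> 4 \<Rightarrow> spacetime \<Rightarrow> multiop" where
  "Omega \<theta> \<alpha> \<beta> x = pd \<alpha> (\<theta> \<beta>) x - pd \<beta> (\<theta> \<alpha>) x + \<theta> \<alpha> x ** \<theta> \<beta> x - \<theta> \<beta> x ** \<theta> \<alpha> x"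

definition Omega_up :: "(4 \<Rightarrow> spacetime \<Rightarrow> multiop) \<Rightarrow> 4 \<Rightarrow> 4 \<Rightarrow> spacetime \<Rightarrow> multiop" where
  "Omega_up \<theta> \<alpha> \<beta> x = (\<Sum>\<mu>\<in>UNIV. \<Sum>\<nu>\<in>UNIV. (eta $ \<alpha> $ \<mu> * eta $ \<beta> $ \<nu>) *\<^sub>R Omega \<theta> \<mu> \<nu> x)"

definition L_V :: "(4 \<Rightarrow> spacetime \<Rightarrow> multiop) \<Rightarrow> spacetime \<Rightarrow> complex" where
  "L_V \<theta> x = plus_cc (1/2 * trace (\<Sum>\<alpha>\<in>UNIV. \<Sum>\<beta>\<in>UNIV. Omega \<theta> \<alpha> \<beta> x ** Omega_up \<theta> \<alpha> \<beta> x))"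

definition Dirac :: "(4 \<Rightarrow> spacetime \<Rightarrow> multiop) \<Rightarrow> (spacetime \<Rightarrow> multivector) \<Rightarrow> spacetime \<Rightarrow> multivector" where
  "Dirac \<theta> \<psi> x = (\<Sum>\<alpha>\<in>UNIV. gamma_up \<alpha> *v (pd \<alpha> \<psi> x + \<theta> \<alpha> x *v \<psi> x))"

definition L_K :: "real \<Rightarrow> (4 \<Rightarrow> spacetime \<Rightarrow> multiop) \<Rightarrow> (spacetime \<Rightarrow> multivector) \<Rightarrow> spacetime \<Rightarrow> complex" where
  "L_K m \<theta> \<psi> x =
     plus_cc (1/2 * dagger_mult (\<psi> x) (etahat *v Dirac \<theta> \<psi> x))
     - complex_of_real m * dagger_mult (\<psi> x) (etahat *v \<psi> x)"

text \<open>The matrix \<open>cos \<zeta> + i sin \<zeta> J\<close>; the scalars are multiples of the identity matrix.\<close>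

definition rot :: "real \<Rightarrow> multiop" where
  "rot \<zeta> = mat (complex_of_real (cos \<zeta>)) + mat (\<i> * complex_of_real (sin \<zeta>)) ** J_op"

definition U :: "real \<Rightarrow> (spacetime \<Rightarrow> real) \<Rightarrow> 4 \<Rightarrow> spacetime \<Rightarrow> multiop" where
  "U \<zeta> \<phi> \<alpha> x = mat (complex_of_real (\<phi> x)) ** rot \<zeta> ** Theta {\<alpha>}"

text \<open>
  Stationarity of the action of a Lagrangian density \<open>L\<close> (a functional of a real scalar field) at the
  field \<open>\<phi>\<close>.  The integral over all of spacetime need not exist, so the action is taken over boxes
  containing the support of the variation \<open>h\<close>.
\<close>

definition stationary :: "((spacetime \<Rightarrow> real) \<Rightarrow> spacetime \<Rightarrow> complex) \<Rightarrow> (spacetime \<Rightarrow> real) \<Rightarrow> bool" where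
  "stationary L \<phi> \<longleftrightarrow>
     (\<forall>h a b. smooth h \<and> closure {x. h x \<noteq> 0} \<subseteq> cbox a b \<longrightarrow>
        ((\<lambda>\<epsilon>. integral (cbox a b) (L (\<lambda>x. \<phi> x + \<epsilon> * h x))) has_vector_derivative 0) (at 0))"


section \<open>The operators \<open>iota\<close> and \<open>Theta\<close> are well defined\<close>

definition eps :: "4 \<Rightarrow> 4 set \<Rightarrow> complex" where
  "eps a J = (-1) ^ card {j \<in> J. j < a}"

lemma eps_sq [simp]: "eps a J * eps a J = 1" "eps a J * (eps a J * x) = x"
  by (simp_all add: eps_def flip: power_mult_distrib mult.assoc)

lemma eps_nz [simp]: "eps a J \<noteq> 0"
  by (simp add: eps_def)

lemma eps_insert: "b \<notin> J \<Longrightarrow> eps a (insert b J) = (if b < a then - eps a J else eps a J)"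
proof -
  assume b: "b \<notin> J"
  have "{j \<in> insert b J. j < a} = (if b < a then insert b {j \<in> J. j < a} else {j \<in> J. j < a})"
    by auto
  then show ?thesis using b by (auto simp: eps_def card_insert_if)
qed

lemma shuffle_left: "a \<notin> I \<Longrightarrow> shuffle_sign (insert a I) J = eps a J * shuffle_sign I J"
proof -
  assume a: "a \<notin> I"
  have "{(i, j). i \<in> insert a I \<and> j \<in> J \<and> j < i} = ({a} \<times> {j \<in> J. j < a}) \<union> {(i, j). i \<in> I \<and> j \<in> J \<and> j < i}"
    by auto
  moreover have "({a} \<times> {j \<in> J. j < a}) \<inter> {(i, j). i \<in> I \<and> j \<in> J \<and> j < i} = {}" using a by auto
  ultimately show ?thesis
    by (simp add: shuffle_sign_def eps_def card_Un_disjoint power_add card_cartesian_product_singleton)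
qed

lemma shuffle_right: "a \<notin> J \<Longrightarrow> shuffle_sign I (insert a J) = (-1) ^ card {i \<in> I. a < i} * shuffle_sign I J"
proof -
  assume a: "a \<notin> J"
  have "{(i, j). i \<in> I \<and> j \<in> insert a J \<and> j < i} = ({i \<in> I. a < i} \<times> {a}) \<union> {(i, j). i \<in> I \<and> j \<in> J \<and> j < i}"
    by auto
  moreover have "({i \<in> I. a < i} \<times> {a}) \<inter> {(i, j). i \<in> I \<and> j \<in> J \<and> j < i} = {}" using a by auto
  ultimately show ?thesis
    by (simp add: shuffle_sign_def card_Un_disjoint power_add card_cartesian_product)
qed

lemma shuffle_nz [simp]: "shuffle_sign I J \<noteq> 0"
  by (simp add: shuffle_sign_def)

lemma shuffle_empty [simp]: "shuffle_sign {} J = 1"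
  by (simp add: shuffle_sign_def)

lemma card_split: "a \<notin> I \<Longrightarrow> (-1) ^ card {i \<in> I. a < i} = (-1) ^ card I * eps a I"
proof -
  assume a: "a \<notin> I"
  have "I = {i \<in> I. a < i} \<union> {i \<in> I. i < a}" using a by auto (metis linorder_neqE)
  moreover have "{i \<in> I. a < i} \<inter> {i \<in> I. i < a} = {}" by auto
  ultimately have "card I = card {i \<in> I. a < i} + card {i \<in> I. i < a}"
    by (metis card_Un_disjoint finite)
  then have "(-1::complex) ^ card I = (-1) ^ card {i \<in> I. a < i} * eps a I"
    by (simp add: power_add eps_def)
  then show ?thesis by (simp add: mult.commute)
qed

lemma wedge_eb: "wedge (eb I) (eb J) = (if I \<inter> J = {} then shuffle_sign I J *s eb (I \<union> J) else 0)"
proof -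
  have "(\<Sum>L\<in>Pow K. shuffle_sign L (K - L) * eb I $ L * eb J $ (K - L)) =
      (\<Sum>L\<in>Pow K. if L = I then (if K - I = J then shuffle_sign I J else 0) else 0)" for K
    by (rule sum.cong) (auto simp: eb_def axis_def)
  then have 1: "wedge (eb I) (eb J) $ K = (if I \<subseteq> K \<and> K - I = J then shuffle_sign I J else 0)" for K
    by (simp add: wedge_def)
  have 2: "I \<subseteq> K \<and> K - I = J \<longleftrightarrow> I \<inter> J = {} \<and> K = I \<union> J" for K
    by auto
  show ?thesis
    unfolding vec_eq_iff 1 2 by (auto simp: eb_def axis_def)
qed

lemma wedge_scale: "wedge (c *s u) v = c *s wedge u v" "wedge u (c *s v) = c *s wedge u v"
  "wedge 0 v = 0" "wedge u 0 = 0"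
  by (simp_all add: wedge_def vec_eq_iff sum_distrib_left mult_ac)

lemma mv_eb: "(A *v eb K) $ I = A $ I $ K"
proof -
  have "(A *v eb K) $ I = (\<Sum>j\<in>UNIV. if j = K then A $ I $ K else 0)"
    unfolding matrix_vector_mult_def eb_def axis_def vec_lambda_beta
    by (rule sum.cong) auto
  then show ?thesis by simp
qed

lemma op_eqI: "(\<And>I. A *v eb I = B *v eb I) \<Longrightarrow> A = (B :: multiop)"
  by (metis mv_eb vec_eq_iff)

lemma matrix_eb: "matrix f *v eb I = f (eb I)"
  unfolding vec_eq_iff mv_eb by (simp add: matrix_def eb_def)

lemma mv_scale: "A *v (c *s v) = c *s (A *v v)" for A :: multiop
  by (simp add: vec_eq_iff matrix_vector_mult_def sum_distrib_left mult_ac)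

lemma eta_off: "a \<noteq> b \<Longrightarrow> eta $ a $ b = 0"
  by (simp add: eta_def)

lemma eps_simps: "eps a {} = 1" "eps a {b} = (if b < a then -1 else 1)"
proof -
  show empty: "eps a {} = 1" by (simp add: eps_def)
  show "eps a {b} = (if b < a then -1 else 1)"
    by (simp only: eps_insert empty empty_iff not_False_eq_True)
qed

definition contr :: "4 \<Rightarrow> multiop" where
  "contr a = (\<chi> K J. if a \<in> J \<and> K = J - {a} then complex_of_real (eta $ a $ a) * eps a J else 0)"

lemma contr_eb: "contr a *v eb J = (if a \<in> J then (complex_of_real (eta $ a $ a) * eps a J) *s eb (J - {a}) else 0)"
  unfolding vec_eq_iff mv_eb by (auto simp: contr_def eb_def axis_def)

lemma is_iota_contr: "is_iota a (contr a)"
  unfolding is_iota_def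
proof (intro conjI allI)
  show "contr a *v eb {} = 0" by (simp add: contr_eb)
  show "contr a *v eb {b} = complex_of_real (eta $ a $ b) *s eb {}" for b
    by (simp add: contr_eb eta_off eps_simps)
  fix I J
  show "contr a *v wedge (eb I) (eb J) = wedge (contr a *v eb I) (eb J) + (-1) ^ card I *s wedge (eb I) (contr a *v eb J)"
  proof (cases "a \<in> I")
    case True
    then obtain I' where I: "I = insert a I'" "a \<notin> I'" by (metis mk_disjoint_insert)
    show ?thesis
    proof (cases "a \<in> J")
      case True
      then obtain J' where J: "J = insert a J'" "a \<notin> J'" by (metis mk_disjoint_insert)
      show ?thesis using I J
        by (auto simp: wedge_eb contr_eb wedge_scale mv_scale shuffle_left shuffle_right card_split
            eps_insert vec_eq_iff)
    next
      case False
      have eps_Un: "eps a (I' \<union> J) = eps a I' * eps a J" if "I' \<inter> J = {}"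
      proof -
        have "{j \<in> I' \<union> J. j < a} = {j \<in> I'. j < a} \<union> {j \<in> J. j < a}" by auto
        moreover have "{j \<in> I'. j < a} \<inter> {j \<in> J. j < a} = {}" using that by auto
        ultimately show ?thesis by (simp add: eps_def card_Un_disjoint power_add)
      qed
      have [simp]: "insert a (I' \<union> J) - {a} = I' \<union> J" using I False by auto
      show ?thesis using I False
        by (auto simp: wedge_eb contr_eb wedge_scale mv_scale shuffle_left eps_Un
            eps_insert vec_eq_iff)
    qed
  next
    case aI: False
    show ?thesis
    proof (cases "a \<in> J")
      case True
      then obtain J' where J: "J = insert a J'" "a \<notin> J'" by (metis mk_disjoint_insert)
      have eps_Un: "eps a (I \<union> J') = eps a I * eps a J'" if "I \<inter> J' = {}"
      proof -
        have "{j \<in> I \<union> J'. j < a} = {j \<in> I. j < a} \<union> {j \<in> J'. j < a}" by auto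
        moreover have "{j \<in> I. j < a} \<inter> {j \<in> J'. j < a} = {}" using that by auto
        ultimately show ?thesis by (simp add: eps_def card_Un_disjoint power_add)
      qed
      have [simp]: "insert a (I \<union> J') - {a} = I \<union> J'" using aI J by auto
      show ?thesis using aI J
        by (auto simp: wedge_eb contr_eb wedge_scale mv_scale shuffle_right card_split eps_Un
            eps_insert vec_eq_iff)
    next
      case False
      then show ?thesis using aI by (simp add: wedge_eb contr_eb wedge_scale mv_scale)
    qed
  qed
qed

lemma is_iota_unique:
  assumes A: "is_iota a A" and B: "is_iota a B"
  shows "A = B"
proof (rule op_eqI)
  fix I :: "4 set"
  have "finite I" by simp
  then show "A *v eb I = B *v eb I"
  proof induction
    case empty
    then show ?case using A B by (simp add: is_iota_def)
  next
    case (insert b I)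
    have ins: "eb (insert b I) = eps b I *s wedge (eb {b}) (eb I)"
      using insert(2) shuffle_left[of b "{}" I] by (simp add: wedge_eb vec_eq_iff)
    have "A *v wedge (eb {b}) (eb I) = B *v wedge (eb {b}) (eb I)"
      using A B insert(3) by (simp add: is_iota_def)
    then show ?case by (simp add: ins mv_scale)
  qed
qed

lemma ex1_iota: "\<exists>!A. is_iota \<alpha> A"
  using is_iota_contr is_iota_unique by blast

lemma iota_eq: "iota a = contr a"
  unfolding iota_def using is_iota_contr is_iota_unique by blast

lemma mv_neg: "A *v (- v) = - (A *v v)" for A :: multiop
  by (simp add: vec_eq_iff matrix_vector_mult_def sum_negf)

lemma gamma_eb: "gamma a *v eb J =
  (if a \<in> J then (- complex_of_real (eta $ a $ a) * eps a J) *s eb (J - {a})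
   else eps a J *s eb (insert a J))"
proof -
  have sh: "shuffle_sign {a} J = eps a J"
    using shuffle_left[of a "{}" J] by simp
  have "gamma a *v eb J = wedge (eb {a}) (eb J) - contr a *v eb J"
    unfolding gamma_def matrix_eb iota_eq ..
  then show ?thesis
    by (cases "a \<in> J") (simp_all add: wedge_eb contr_eb sh vec_eq_iff)
qed

definition rmult :: "4 \<Rightarrow> multiop" where
  "rmult a = (\<chi> K J. (-1) ^ card J * eps a J *
     (if a \<in> J then if K = J - {a} then complex_of_real (eta $ a $ a) else 0
      else if K = insert a J then 1 else 0))"

lemma rmult_eb: "rmult a *v eb J =
  (if a \<in> J then ((-1) ^ card J * complex_of_real (eta $ a $ a) * eps a J) *s eb (J - {a})
   else ((-1) ^ card J * eps a J) *s eb (insert a J))"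
  by (cases "a \<in> J") (simp_all add: vec_eq_iff mv_eb, simp_all add: rmult_def eb_def axis_def)

lemma rmult_comm: "rmult a ** gamma b = gamma b ** rmult a"
proof (rule op_eqI)
  fix J
  have "rmult a *v (gamma b *v eb J) = gamma b *v (rmult a *v eb J)"
  proof (cases "a = b")
    case True
    show ?thesis
    proof (cases "a \<in> J")
      case aJ: True
      then obtain K where "J = insert a K" "a \<notin> K" by (metis mk_disjoint_insert)
      with True show ?thesis
        by (simp add: gamma_eb rmult_eb mv_scale mv_neg eps_insert vec_eq_iff)
    next
      case False
      with True show ?thesis
        by (simp add: gamma_eb rmult_eb mv_scale mv_neg eps_insert vec_eq_iff)
    qed
  next
    case ab: False
    then have cases: "b < a \<and> \<not> a < b \<or> a < b \<and> \<not> b < a" by auto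
    define K where "K = J - {a, b}"
    have K: "a \<notin> K" "b \<notin> K" "insert b (insert a K) = insert a (insert b K)"
      "insert a K - {b} = insert a K" "insert b K - {a} = insert b K"
      "insert a (insert b K) - {a} = insert b K" "insert a (insert b K) - {b} = insert a K"
      "insert a K - {a} = K" "insert b K - {b} = K"
      "b \<notin> insert a K" "a \<notin> insert b K"
      using ab by (auto simp: K_def)
    have "J = K \<or> J = insert a K \<or> J = insert b K \<or> J = insert a (insert b K)"
      by (auto simp: K_def)
    then show ?thesis
      using cases ab
      by (elim disjE conjE; simp add: gamma_eb rmult_eb mv_scale mv_neg eps_insert K vec_eq_iff)
  qed
  then show "(rmult a ** gamma b) *v eb J = (gamma b ** rmult a) *v eb J"
    by (simp add: matrix_vector_mul_assoc)
qed

lemma is_Theta_unique: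
  assumes A: "is_Theta K A" and B: "is_Theta K B"
  shows "A = B"
proof (rule op_eqI)
  fix I :: "4 set"
  have "finite I" by simp
  then show "A *v eb I = B *v eb I"
  proof induction
    case empty
    then show ?case using A B by (simp add: is_Theta_def)
  next
    case (insert b I)
    have ins: "eb (insert b I) = eps b I *s (gamma b *v eb I)"
      using insert(2) by (simp add: gamma_eb vec_eq_iff)
    have "A *v (gamma b *v eb I) = gamma b *v (A *v eb I)" "B *v (gamma b *v eb I) = gamma b *v (B *v eb I)"
      using A B by (simp_all add: is_Theta_def matrix_vector_mul_assoc)
    then show ?case using insert(3) by (simp add: ins mv_scale)
  qed
qed

lemma is_Theta_exists: "\<exists>A. is_Theta I A"
proof -
  have "finite I" by simp
  then show ?thesis
  proof (induction rule: finite_linorder_max_induct)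
    case empty
    have "is_Theta {} (mat 1)" by (simp add: is_Theta_def)
    then show ?case ..
  next
    case (insert b I)
    then obtain A where A: "is_Theta I A" by blast
    have bI: "b \<notin> I" using insert(2) by auto
    have "{j \<in> I. j < b} = I" using insert(2) by auto
    then have e: "(-1) ^ card I * eps b I = 1" by (simp add: eps_def flip: power_mult_distrib)
    have "is_Theta (insert b I) (rmult b ** A)"
      unfolding is_Theta_def
    proof (intro conjI allI)
      fix c
      show "rmult b ** A ** gamma c = gamma c ** (rmult b ** A)"
      proof -
        have "rmult b ** A ** gamma c = rmult b ** (A ** gamma c)"
          by (rule matrix_mul_assoc[symmetric])
        also have "A ** gamma c = gamma c ** A"
          using A unfolding is_Theta_def by blast
        also have "rmult b ** (gamma c ** A) = rmult b ** gamma c ** A"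
          by (rule matrix_mul_assoc)
        also have "\<dots> = gamma c ** rmult b ** A"
          by (simp only: rmult_comm)
        also have "\<dots> = gamma c ** (rmult b ** A)"
          by (rule matrix_mul_assoc[symmetric])
        finally show ?thesis .
      qed
      show "(rmult b ** A) *v eb {} = eb (insert b I)"
      proof -
        have "(rmult b ** A) *v eb {} = rmult b *v (A *v eb {})"
          by (rule matrix_vector_mul_assoc[symmetric])
        also have "A *v eb {} = eb I"
          using A unfolding is_Theta_def by blast
        also have "rmult b *v eb I = eb (insert b I)"
          using bI e by (simp only: rmult_eb if_False) (simp add: vec_eq_iff)
        finally show ?thesis .
      qed
    qed
    then show ?case ..
  qed
qed

lemma ex1_Theta: "\<exists>!A. is_Theta I A"
  using is_Theta_exists is_Theta_unique by blast

end

(* Each Theta_a commutes with all gamma matrices, so it is determined by its value on the scalar unit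
   e_{} and acts as signed multiplication from the other side; the Theta_a satisfy
   Theta_a Theta_b + Theta_b Theta_a = - 2 eta_ab and J = Theta_0123 anticommutes with each of them,
   J^2 = -1.  Hence R = cos zeta + i sin zeta J satisfies R Theta_a = Theta_a R', with R' the rotation by -zeta
   and R R' = cos 2 zeta.  So the curvature is d_a phi R Theta_b - d_b phi R Theta_a
   + 2 phi^2 cos 2 zeta Theta_a Theta_b, products of an odd number of Thetas are traceless, and L_V follows.
   The source gamma^a R Theta_a is self-adjoint for the extended metric because gamma_a and Theta_a are
   skew-adjoint and J is self-adjoint; this makes L_K affine in phi with a real coefficient.
   The action along phi + eps h is then a polynomial in eps; integration by parts (translation invariance of
   the integral) and a bump function turn the vanishing of its linear coefficient into the field equation. *)

theory Submission
  imports Defs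
begin

section \<open>The commutant of the gamma matrices\<close>

lemma Theta_eqI: "is_Theta I A \<Longrightarrow> Theta I = A"
  unfolding Theta_def using is_Theta_unique by blast

text \<open>\<open>rmult a\<close> is Clifford multiplication by e_a from the right, where e_a
  squares to - eta_aa; the gammas multiply from the left, hence the commutation.\<close>

lemma Theta_singleton: "Theta {a} = rmult a"
  by (rule Theta_eqI) (simp add: is_Theta_def rmult_comm rmult_eb eps_simps)

lemma is_Theta_J_op: "is_Theta {0, 1, 2, 3} J_op"
  unfolding J_op_def using is_Theta_exists Theta_eqI by metis

lemma index_less:
  "(0::4) < 1" "(0::4) < 2" "(0::4) < 3" "(1::4) < 2" "(1::4) < 3" "(2::4) < 3"
  "\<not> (1::4) < 0" "\<not> (2::4) < 0" "\<not> (3::4) < 0" "\<not> (2::4) < 1" "\<not> (3::4) < 1" "\<not> (3::4) < 2"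
  by (simp_all add: less_bit0_def bit0.Rep_numeral bit0.Rep_1 bit0.Rep_0)

lemma matrix_mul_minus:
  fixes A B :: multiop
  shows "(- A) ** B = - (A ** B)" "A ** (- B) = - (A ** B)"
  by (simp_all add: matrix_matrix_mult_def vec_eq_iff sum_negf)

lemma minus_mv: "(- A) *v v = - (A *v v)" for A :: multiop
  by (simp add: vec_eq_iff matrix_vector_mult_def sum_negf)

text \<open>An algebra containing all Thetas; an identity between its members can be tested on the
  single vector \<open>eb {}\<close>.\<close>

definition commutant :: "multiop set" where
  "commutant = {A. \<forall>a. A ** gamma a = gamma a ** A}"

lemma rmult_in_commutant: "rmult a \<in> commutant"
  by (simp add: commutant_def rmult_comm)

lemma mult_in_commutant: "A \<in> commutant \<Longrightarrow> B \<in> commutant \<Longrightarrow> A ** B \<in> commutant"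
  by (simp add: commutant_def) (metis matrix_mul_assoc)

lemma scaleR_in_commutant: "A \<in> commutant \<Longrightarrow> c *\<^sub>R A \<in> commutant"
  by (simp add: commutant_def matrix_scalar_ac flip: scalar_matrix_assoc)

lemma minus_in_commutant: "A \<in> commutant \<Longrightarrow> - A \<in> commutant"
  by (simp add: commutant_def matrix_mul_minus)

lemma mat_1_in_commutant: "mat 1 \<in> commutant"
  by (simp add: commutant_def)

lemmas commutant_intros = rmult_in_commutant mult_in_commutant scaleR_in_commutant
  minus_in_commutant mat_1_in_commutant

text \<open>The gamma matrices generate the whole exterior algebra from \<^term>\<open>eb {}\<close>.\<close>

lemma commutant_eqI:
  assumes e: "A *v eb {} = B *v eb {}" and A: "A \<in> commutant" and B: "B \<in> commutant"
  shows "A = B"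
proof (rule op_eqI)
  fix I :: "4 set"
  have "finite I" by simp
  then show "A *v eb I = B *v eb I"
  proof induction
    case empty
    then show ?case by (rule e)
  next
    case (insert b I)
    have ins: "eb (insert b I) = eps b I *s (gamma b *v eb I)"
      using insert(2) by (simp add: gamma_eb vec_eq_iff)
    have "A *v (gamma b *v eb I) = gamma b *v (A *v eb I)" "B *v (gamma b *v eb I) = gamma b *v (B *v eb I)"
      using A B by (simp_all add: commutant_def matrix_vector_mul_assoc)
    then show ?case using insert(3) by (simp add: ins mv_scale)
  qed
qed

section \<open>Clifford relations of the Thetas and of J, by evaluation on
  \<open>eb {}\<close>\<close>

lemma scaleR_mv: "(c *\<^sub>R A) *v v = complex_of_real c *s (A *v v)" for A :: multiop
  unfolding vec_eq_iff matrix_vector_mult_def vector_scaleR_component vec_lambda_beta vector_smult_component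
  by (simp add: sum_distrib_left mult_ac scaleR_conv_of_real)

lemmas op_eval = scaleR_mv minus_mv mv_neg mv_scale rmult_eb gamma_eb eps_simps
  matrix_vector_mul_assoc[symmetric]

lemma rmult_sq: "rmult a ** rmult a = (- (eta $ a $ a)) *\<^sub>R mat 1"
  by (rule commutant_eqI; (intro commutant_intros)?)
    (simp add: op_eval del: scaleR_minus_left)

text \<open>Both products send \<open>eb {}\<close> to a multiple of \<open>eb {a, b}\<close>;
  exactly one of a and b is the smaller, so the \<open>eps\<close> signs differ.\<close>

lemma rmult_anticomm: "a \<noteq> b \<Longrightarrow> rmult a ** rmult b = - (rmult b ** rmult a)"
  by (rule commutant_eqI; (intro commutant_intros)?)
     (auto simp: op_eval insert_commute not_less_iff_gr_or_eq)

lemma J_op_eb: "J_op *v eb {} = eb {0, 1, 2, 3}"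
  using is_Theta_J_op by (simp add: is_Theta_def)

lemma J_op_in_commutant: "J_op \<in> commutant"
  using is_Theta_J_op by (simp add: is_Theta_def commutant_def)

text \<open>Appending e_0, e_1, e_2, e_3 on the right in turn builds the ordered wedge without any
  sign.\<close>

lemma J_op_eq: "J_op = rmult 3 ** (rmult 2 ** (rmult 1 ** rmult 0))"
  by (rule commutant_eqI; (intro commutant_intros J_op_in_commutant)?)
    (simp add: op_eval J_op_eb eps_insert index_less, rule arg_cong[where f=eb], blast)

text \<open>Reversing four anticommuting factors takes six swaps, an even number. Both orders are
  needed because adjoints reverse products.\<close>

lemma J_op_eq_rev: "J_op = rmult 0 ** (rmult 1 ** (rmult 2 ** rmult 3))"
  by (rule commutant_eqI; (intro commutant_intros J_op_in_commutant)?)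
    (simp add: op_eval J_op_eb eps_insert index_less)

lemma J_op_sq: "J_op ** J_op = - mat 1"
proof (rule commutant_eqI; (intro commutant_intros J_op_in_commutant)?)
  have "{0, 1, 2, 3} - {0::4} = {1,2,3}" "{1, 2, 3} - {1::4} = {2,3}"  "{2, 3} - {2::4} = {3}"
    by (simp_all add: insert_Diff_if)
  \<comment> \<open>Stripping the indices in increasing order keeps every \<open>eps\<close> equal
    to 1, so the sign is (-1)^(4+3+2+1) times det eta, that is -1.\<close>
  then have "J_op *v eb {0, 1, 2, 3} = - eb {}"
    by (subst J_op_eq) (simp add: op_eval eps_insert index_less vec_eq_iff eta_def)
  then show "J_op ** J_op *v eb {} = - mat 1 *v eb {}"
    by (simp add: op_eval J_op_eb)
qed

text \<open>\<open>rmult a\<close> and \<open>gamma a\<close> agree on \<open>eb {}\<close>, and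
  \<open>gamma a\<close> can be pulled through J, so only their actions on the top element have to
  be compared.\<close>

lemma J_op_rmult: "J_op ** rmult a = - (rmult a ** J_op)"
proof (rule commutant_eqI; (intro commutant_intros J_op_in_commutant)?)
  have a: "a \<in> {0, 1, 2, 3}"
    using exhaust_4[of a] by auto
  have "(J_op ** rmult a) *v eb {} = J_op *v eb {a}"
    by (simp add: op_eval)
  also have "\<dots> = J_op *v (gamma a *v eb {})"
    by (simp add: op_eval)
  also have "\<dots> = gamma a *v (J_op *v eb {})"
    using J_op_in_commutant by (simp add: commutant_def matrix_vector_mul_assoc)
  \<comment> \<open>Every index lies in the top element, whose degree 4 is even: there
    \<open>gamma a\<close> contracts with the sign opposite to that of
    \<open>rmult a\<close>.\<close>
  also have "\<dots> = - (rmult a ** J_op) *v eb {}"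
    unfolding J_op_eb op_eval using a by (simp only: if_True) (simp add: vec_eq_iff)
  finally show "(J_op ** rmult a) *v eb {} = - (rmult a ** J_op) *v eb {}" .
qed

section \<open>Scalar matrices and the rotation cos zeta + i sin zeta J\<close>

lemma matrix_mul_diff:
  fixes A B C :: multiop
  shows "(A - B) ** C = A ** C - B ** C" "A ** (B - C) = A ** B - A ** C"
  by (simp_all add: matrix_matrix_mult_def vec_eq_iff sum_subtractf algebra_simps)

lemma matrix_mul_add: "(A + B) ** C = A ** C + B ** C" for A B C :: multiop
  by (simp add: matrix_matrix_mult_def vec_eq_iff sum.distrib algebra_simps)

lemma mat_nth: "(mat c :: multiop) $ i $ j = (if i = j then c else 0)"
  by (simp add: mat_def)

lemma mat_mul_nth:
  fixes A :: multiop
  shows "(mat c ** A) $ i $ j = c * A $ i $ j" "(A ** mat c) $ i $ j = c * A $ i $ j"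
proof -
  have "(\<Sum>k\<in>UNIV. (mat c :: multiop) $ i $ k * A $ k $ j) = (\<Sum>k\<in>UNIV. if k = i then c * A $ i $ j else 0)"
    "(\<Sum>k\<in>UNIV. A $ i $ k * (mat c :: multiop) $ k $ j) = (\<Sum>k\<in>UNIV. if k = j then c * A $ i $ j else 0)"
    by (rule sum.cong; simp add: mat_nth)+
  then show "(mat c ** A) $ i $ j = c * A $ i $ j" "(A ** mat c) $ i $ j = c * A $ i $ j"
    by (simp_all add: matrix_matrix_mult_def)
qed

lemma mat_mul_commute: "mat c ** A = A ** mat c" for A :: multiop
  by (simp add: vec_eq_iff mat_mul_nth)

lemma mat_mul_mat: "mat c ** mat d = (mat (c * d) :: multiop)"
  by (simp add: vec_eq_iff mat_mul_nth mat_nth)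

lemma mat_of_real_mul: "mat (complex_of_real c) ** A = c *\<^sub>R A" for A :: multiop
  by (simp only: vec_eq_iff mat_mul_nth vector_scaleR_component) (simp add: scaleR_conv_of_real)

lemma rot_minus: "rot (- \<zeta>) = mat (complex_of_real (cos \<zeta>)) - mat (\<i> * complex_of_real (sin \<zeta>)) ** J_op"
  by (simp add: rot_def vec_eq_iff mat_mul_nth mat_nth)

lemma rot_rmult: "rot \<zeta> ** rmult a = rmult a ** rot (- \<zeta>)"
proof -
  have "mat c ** J_op ** rmult a = - (rmult a ** (mat c ** J_op))" for c
  proof -
    have "mat c ** J_op ** rmult a = - (mat c ** rmult a ** J_op)"
      by (simp only: J_op_rmult matrix_mul_minus flip: matrix_mul_assoc)
    also have "mat c ** rmult a = rmult a ** mat c"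
      by (rule mat_mul_commute)
    finally show ?thesis
      by (simp only: matrix_mul_assoc)
  qed
  then show ?thesis
    unfolding rot_minus by (simp add: rot_def matrix_mul_add matrix_mul_diff mat_mul_commute)
qed

text \<open>A difference of squares, c^2 - s^2 J^2 with s = i sin zeta; both J^2 and i^2 contribute
  a sign, leaving cos^2 - sin^2.\<close>

lemma rot_rot_minus: "rot \<zeta> ** rot (- \<zeta>) = cos (2 * \<zeta>) *\<^sub>R mat 1"
proof -
  define c where "c = complex_of_real (cos \<zeta>)"
  define s where "s = \<i> * complex_of_real (sin \<zeta>)"
  have "mat s ** J_op ** (mat s ** J_op) = mat s ** mat s ** (J_op ** J_op)"
    by (metis mat_mul_commute matrix_mul_assoc)
  then have sq: "mat s ** J_op ** (mat s ** J_op) = - mat (s * s)"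
    by (simp add: J_op_sq matrix_mul_minus mat_mul_mat)
  have "rot \<zeta> ** rot (- \<zeta>) = mat (c * c) + mat (s * s)"
    unfolding rot_minus unfolding rot_def c_def[symmetric] s_def[symmetric]
    by (simp add: matrix_mul_add matrix_mul_diff sq mat_mul_mat) (simp add: mat_mul_commute)
  also have "\<dots> = mat (complex_of_real (cos (2 * \<zeta>))) ** mat 1"
    by (simp add: mat_nth vec_eq_iff c_def s_def cos_double power2_eq_square)
      (simp add: algebra_simps)
  finally show ?thesis by (simp only: mat_of_real_mul)
qed

definition theta_op :: "real \<Rightarrow> 4 \<Rightarrow> multiop" where
  "theta_op \<zeta> a = rot \<zeta> ** rmult a"

lemma U_eq: "U \<zeta> \<phi> a x = \<phi> x *\<^sub>R theta_op \<zeta> a"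
  unfolding U_def theta_op_def Theta_singleton mat_of_real_mul by (rule scalar_matrix_assoc[symmetric])

text \<open>Moving the inner \<open>rmult a\<close> past the second rotation reverses the angle
  there, so the two rotations collapse to a scalar.\<close>

lemma theta_op_mult: "theta_op \<zeta> a ** theta_op \<zeta> b = cos (2 * \<zeta>) *\<^sub>R (rmult a ** rmult b)"
proof -
  have "theta_op \<zeta> a ** theta_op \<zeta> b = rot \<zeta> ** (rmult a ** rot \<zeta>) ** rmult b"
    by (simp add: theta_op_def matrix_mul_assoc)
  also have "rmult a ** rot \<zeta> = rot (- \<zeta>) ** rmult a"
    using rot_rmult[of "- \<zeta>" a] by simp
  also have "rot \<zeta> ** (rot (- \<zeta>) ** rmult a) ** rmult b = (rot \<zeta> ** rot (- \<zeta>)) ** (rmult a ** rmult b)"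
    by (simp add: matrix_mul_assoc)
  finally show ?thesis by (simp add: rot_rot_minus flip: scalar_matrix_assoc)
qed

lemma J_op_theta_op: "J_op ** theta_op \<zeta> a = - (theta_op \<zeta> a ** J_op)"
proof -
  have "J_op ** rot \<zeta> = rot \<zeta> ** J_op"
    unfolding rot_def matrix_mul_add matrix_add_ldistrib
    by (metis mat_mul_commute matrix_mul_assoc)
  then show ?thesis
    unfolding theta_op_def by (metis J_op_rmult matrix_mul_assoc matrix_mul_minus(2))
qed

lemma J_op_theta_op_left: "J_op ** (theta_op \<zeta> a ** A) = - (theta_op \<zeta> a ** (J_op ** A))" for A :: multiop
  by (simp only: matrix_mul_assoc J_op_theta_op matrix_mul_minus)

section \<open>Traces of products of Thetas\<close>

lemma trace_scaleR: "trace (c *\<^sub>R A) = complex_of_real c * trace A" for A :: multiop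
  by (simp add: trace_def sum_distrib_left scaleR_conv_of_real[where 'a=complex])

lemma trace_minus: "trace (- A) = - trace A" for A :: multiop
  by (simp add: trace_def sum_negf)

text \<open>Oddness gives J A J = A, while cyclicity of the trace gives tr(J A J) = tr(A J^2) = - tr
  A.\<close>

lemma trace_eq_0_if_odd:
  assumes "J_op ** A = - (A ** J_op)"
  shows "trace A = 0"
proof -
  have "J_op ** A ** J_op = A"
    unfolding assms by (simp add: matrix_mul_minus J_op_sq flip: matrix_mul_assoc)
  moreover have "trace (J_op ** A ** J_op) = trace (A ** (J_op ** J_op))"
    by (metis matrix_mul_assoc trace_mul_sym)
  ultimately show ?thesis by (simp add: J_op_sq matrix_mul_minus trace_minus)
qed

text \<open>16 is the dimension of the exterior algebra; for distinct indices, anticommutation and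
  cyclicity make the trace its own negative.\<close>

lemma trace_rmult_rmult: "trace (rmult a ** rmult b) = complex_of_real (- 16 * eta $ a $ b)"
proof (cases "a = b")
  case True
  then show ?thesis
    by (simp add: rmult_sq trace_scaleR trace_minus trace_I)
next
  case False
  then have "trace (rmult a ** rmult b) = - trace (rmult a ** rmult b)"
    by (metis rmult_anticomm trace_minus trace_mul_sym)
  with False show ?thesis by (simp add: eta_off)
qed

definition theta_comm :: "real \<Rightarrow> 4 \<Rightarrow> 4 \<Rightarrow> multiop" where
  "theta_comm \<zeta> a b = theta_op \<zeta> a ** theta_op \<zeta> b - theta_op \<zeta> b ** theta_op \<zeta> a"

lemma theta_comm_eq: "theta_comm \<zeta> a b = (if a = b then 0 else (2 * cos (2 * \<zeta>)) *\<^sub>R (rmult a ** rmult b))"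
  using rmult_anticomm[of b a]
  by (auto simp: theta_comm_def theta_op_mult simp flip: scaleR_add_left)

lemma trace_theta_op_2: "trace (theta_op \<zeta> a ** theta_op \<zeta> b) = complex_of_real (- 16 * cos (2 * \<zeta>) * eta $ a $ b)"
  by (simp add: theta_op_mult trace_scaleR trace_rmult_rmult)

lemma trace_theta_op_3: "trace (theta_op \<zeta> a ** (theta_op \<zeta> b ** theta_op \<zeta> c)) = 0"
proof (rule trace_eq_0_if_odd)
  show "J_op ** (theta_op \<zeta> a ** (theta_op \<zeta> b ** theta_op \<zeta> c)) = - (theta_op \<zeta> a ** (theta_op \<zeta> b ** theta_op \<zeta> c) ** J_op)"
    by (simp only: J_op_theta_op J_op_theta_op_left matrix_mul_minus minus_minus flip: matrix_mul_assoc)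
qed

lemma trace_theta_op_comm: "trace (theta_op \<zeta> a ** theta_comm \<zeta> b c) = 0" "trace (theta_comm \<zeta> b c ** theta_op \<zeta> a) = 0"
  by (simp_all add: theta_comm_def matrix_mul_diff trace_sub trace_theta_op_3 trace_mul_sym[of _ "theta_op \<zeta> a"])

lemma trace_theta_comm_sq: "trace (theta_comm \<zeta> a b ** theta_comm \<zeta> a b) =
  complex_of_real (if a = b then 0 else - 64 * (cos (2 * \<zeta>))\<^sup>2 * eta $ a $ a * eta $ b $ b)"
proof (cases "a = b")
  case False
  \<comment> \<open>Swapping the two inner factors costs one sign and leaves two squares.\<close>
  have "rmult a ** rmult b ** (rmult a ** rmult b) = - (rmult a ** rmult a ** (rmult b ** rmult b))"
    using rmult_anticomm[of b a] False by (metis matrix_mul_assoc matrix_mul_minus)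
  also have "\<dots> = - ((eta $ a $ a * eta $ b $ b) *\<^sub>R mat 1)"
    by (simp add: rmult_sq matrix_mul_minus matrix_scalar_ac flip: scalar_matrix_assoc)
  finally show ?thesis using False
    by (simp add: theta_comm_eq matrix_scalar_ac trace_scaleR trace_minus trace_I power2_eq_square
         flip: scalar_matrix_assoc)
qed (simp add: theta_comm_eq trace_def)

section \<open>Self-adjointness with respect to the extended metric\<close>

definition hsign :: "4 set \<Rightarrow> complex" where
  "hsign I = complex_of_real (\<Prod>i\<in>I. eta $ i $ i)"

lemma cnj_hsign: "cnj (hsign I) = hsign I"
  by (simp add: hsign_def)

lemma hsign_insert: "a \<notin> I \<Longrightarrow> hsign (insert a I) = complex_of_real (eta $ a $ a) * hsign I"
  by (simp add: hsign_def)

text \<open>As \<open>eta\<close> is diagonal, a Leibniz term survives only if the permutation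
  matches the two sorted lists entry by entry; this forces I = J and the identity
  permutation.\<close>

lemma etahat_eq: "etahat $ I $ J = (if I = J then hsign I else 0)"
proof (cases "card I = card J")
  case False
  then show ?thesis by (auto simp: etahat_def)
next
  case card: True
  define xs where "xs = sorted_list_of_set I"
  define ys where "ys = sorted_list_of_set J"
  have xs: "distinct xs" "set xs = I" "length xs = card I" and ys: "distinct ys" "set ys = J" "length ys = card I"
    by (simp_all add: xs_def ys_def card)
  have bij: "bij_betw ((!) xs) {..<card I} I"
    by (rule bij_betw_nth) (simp_all only: xs)
  have zero: "(\<Prod>i<card I. eta $ (xs ! i) $ (ys ! p i)) = 0"
    if p: "p permutes {..<card I}" and ne: "\<exists>i<card I. xs ! i \<noteq> ys ! p i" for p
    using ne eta_off by (auto intro!: prod_zero)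
  have leibniz: "etahat $ I $ J = complex_of_real (\<Sum>p | p permutes {..<card I}.
      of_int (sign p) * (\<Prod>i<card I. eta $ (xs ! i) $ (ys ! p i)))"
    using card unfolding etahat_def xs_def ys_def by simp
  show ?thesis
  proof (cases "I = J")
    case True
    then have "ys = xs" by (simp add: xs_def ys_def)
    have "(\<Prod>i<card I. eta $ (xs ! i) $ (xs ! p i)) = 0"
      if p: "p permutes {..<card I}" and ne: "p \<noteq> id" for p
    proof -
      obtain i where i: "p i \<noteq> i" using ne by (auto simp: fun_eq_iff)
      \<comment> \<open>A moved index stays in range, and distinctness of the list turns it into an
        off-diagonal entry of \<open>eta\<close>.\<close>
      then have "i < card I" using p by (metis lessThan_iff permutes_not_in)
      moreover from this have "p i < card I" using p by (metis lessThan_iff permutes_in_image)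
      ultimately show ?thesis
        using zero[OF p] \<open>ys = xs\<close> i xs by (metis nth_eq_iff_index_eq)
    qed
    then have "(\<Sum>p | p permutes {..<card I}. of_int (sign p) * (\<Prod>i<card I. eta $ (xs ! i) $ (xs ! p i)))
       = (\<Sum>p\<in>{id}. of_int (sign p) * (\<Prod>i<card I. eta $ (xs ! i) $ (xs ! p i)))"
      by (intro sum.mono_neutral_right) (auto simp: permutes_id finite_permutations)
    also have "\<dots> = (\<Prod>i\<in>I. eta $ i $ i)"
      using prod.reindex_bij_betw[OF bij, of "\<lambda>i. eta $ i $ i"] by simp
    finally show ?thesis
      unfolding leibniz hsign_def \<open>ys = xs\<close> using True by simp
  next
    case False
    \<comment> \<open>Without a mismatch I would be contained in J, hence equal to it, as the
      cardinalities agree.\<close>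
    have "\<exists>i<card I. xs ! i \<noteq> ys ! p i" if p: "p permutes {..<card I}" for p
    proof (rule ccontr)
      assume "\<not> (\<exists>i<card I. xs ! i \<noteq> ys ! p i)"
      then have "\<forall>i<card I. xs ! i \<in> J"
        using p ys by (metis lessThan_iff nth_mem permutes_in_image)
      then have "I \<subseteq> J" using xs by (metis in_set_conv_nth subsetI)
      then show False using False card by (metis card_subset_eq finite)
    qed
    with zero have "(\<Sum>p | p permutes {..<card I}. of_int (sign p) * (\<Prod>i<card I. eta $ (xs ! i) $ (ys ! p i))) = 0"
      by (intro sum.neutral) auto
    then show ?thesis unfolding leibniz using False by simp
  qed
qed

section \<open>The indefinite Hermitian form of the extended metric and its adjoints\<close>

definition hform :: "multivector \<Rightarrow> multivector \<Rightarrow> complex" where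
  "hform u v = dagger_mult u (etahat *v v)"

lemma hform_eq: "hform u v = (\<Sum>I\<in>UNIV. cnj (u $ I) * hsign I * v $ I)"
  unfolding hform_def dagger_mult_def matrix_vector_mult_def vec_lambda_beta
  by (rule sum.cong) (simp_all add: etahat_eq if_distrib if_distribR mult.assoc cong: if_cong)

lemma hform_cnj: "cnj (hform u v) = hform v u"
  unfolding hform_eq by (simp add: cnj_hsign mult_ac)

definition is_adj :: "multiop \<Rightarrow> multiop \<Rightarrow> bool" where
  "is_adj A B \<longleftrightarrow> (\<forall>u v. hform u (A *v v) = hform (B *v u) v)"

lemma is_adj_mult: "is_adj A A' \<Longrightarrow> is_adj B B' \<Longrightarrow> is_adj (A ** B) (B' ** A')"
  by (simp add: is_adj_def flip: matrix_vector_mul_assoc)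

lemma hform_add: "hform (u + v) w = hform u w + hform v w" "hform w (u + v) = hform w u + hform w v"
  by (simp_all add: hform_eq sum.distrib algebra_simps)

lemma hform_smult: "hform (c *s u) w = cnj c * hform u w" "hform w (c *s u) = c * hform w u"
  by (simp_all add: hform_eq sum_distrib_left mult_ac)

lemma is_adj_add: "is_adj A A' \<Longrightarrow> is_adj B B' \<Longrightarrow> is_adj (A + B) (A' + B')"
  by (simp add: is_adj_def matrix_vector_mult_add_rdistrib hform_add)

lemma is_adj_mat: "is_adj (mat c) (mat (cnj c))"
proof -
  have "mat c *v v = c *s v" for c and v :: multivector
    by (simp add: matrix_vector_mult_def mat_def vec_eq_iff if_distrib if_distribR cong: if_cong)
  then show ?thesis by (simp add: is_adj_def hform_smult)
qed

text \<open>The form is diagonal with entries \<open>hsign\<close>, so adjointness can be checked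
  entry by entry; the double sum is then exchanged.\<close>

lemma is_adjI:
  assumes "\<And>I J. hsign I * A $ I $ J = cnj (B $ J $ I) * hsign J"
  shows "is_adj A B"
  unfolding is_adj_def hform_eq matrix_vector_mult_def vec_lambda_beta
proof (intro allI)
  fix u v :: multivector
  have "(\<Sum>I\<in>UNIV. cnj (u $ I) * hsign I * (\<Sum>J\<in>UNIV. A $ I $ J * v $ J))
    = (\<Sum>I\<in>UNIV. \<Sum>J\<in>UNIV. cnj (u $ I) * (hsign I * A $ I $ J) * v $ J)"
    by (simp add: sum_distrib_left mult_ac)
  also have "\<dots> = (\<Sum>J\<in>UNIV. \<Sum>I\<in>UNIV. cnj (u $ I) * (cnj (B $ J $ I) * hsign J) * v $ J)"
    unfolding assms by (rule sum.swap)
  also have "\<dots> = (\<Sum>J\<in>UNIV. cnj (\<Sum>I\<in>UNIV. B $ J $ I * u $ I) * hsign J * v $ J)"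
    by (simp add: sum_distrib_left sum_distrib_right mult_ac)
  finally show "(\<Sum>I\<in>UNIV. cnj (u $ I) * hsign I * (\<Sum>J\<in>UNIV. A $ I $ J * v $ J))
    = (\<Sum>J\<in>UNIV. cnj (\<Sum>I\<in>UNIV. B $ J $ I * u $ I) * hsign J * v $ J)" .
qed

lemma eta_sq:
  "complex_of_real (eta $ a $ a) * complex_of_real (eta $ a $ a) = 1"
  "complex_of_real (eta $ a $ a) * (complex_of_real (eta $ a $ a) * z) = z"
  by (simp_all add: eta_def)

lemma cnj_eps: "cnj (eps a J) = eps a J"
  by (simp add: eps_def)

lemma gamma_nth: "gamma a $ I $ J =
  (if a \<in> J then if I = J - {a} then - complex_of_real (eta $ a $ a) * eps a J else 0
   else if I = insert a J then eps a J else 0)"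
  unfolding mv_eb[symmetric] gamma_eb by (auto simp: eb_def axis_def)

text \<open>Turns removal into insertion, the shape in which \<open>hsign_insert\<close> and
  \<open>eps_insert\<close> apply.\<close>

lemma remove_eq_iff: "a \<in> J \<Longrightarrow> I = J - {a} \<longleftrightarrow> a \<notin> I \<and> J = insert a I"
  by auto

text \<open>Exterior multiplication and contraction by e_a are adjoint to each other, and
  \<open>gamma a\<close> is their difference.\<close>

lemma is_adj_gamma: "is_adj (gamma a) (- gamma a)"
proof (rule is_adjI)
  fix I J
  show "hsign I * gamma a $ I $ J =
       cnj ((- gamma a) $ J $ I) * hsign J"
  proof (cases "a \<in> J")
    case True
    then show ?thesis
      by (auto simp: gamma_nth remove_eq_iff hsign_insert eps_insert cnj_eps eta_sq mult_ac)
  next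
    case False
    then show ?thesis
      by (auto simp: gamma_nth remove_eq_iff hsign_insert eps_insert cnj_eps eta_sq mult_ac)
  qed
qed

text \<open>The degree sign in \<open>rmult\<close> is taken at sets whose sizes differ by one,
  which makes the raising and lowering parts adjoint up to a sign.\<close>

lemma is_adj_rmult: "is_adj (rmult a) (- rmult a)"
proof (rule is_adjI)
  fix I J
  show "hsign I * rmult a $ I $ J =
       cnj ((- rmult a) $ J $ I) * hsign J"
  proof (cases "a \<in> J")
    case True
    then show ?thesis
      by (auto simp: rmult_def remove_eq_iff hsign_insert eps_insert cnj_eps eta_sq mult_ac)
  next
    case False
    then show ?thesis
      by (auto simp: rmult_def remove_eq_iff hsign_insert eps_insert cnj_eps eta_sq mult_ac)
  qed
qed

text \<open>Taking the adjoint reverses the four factors, and their four signs cancel; the reversed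
  product is again J.\<close>

lemma is_adj_J_op: "is_adj J_op J_op"
proof -
  have "is_adj J_op ((((- rmult 0) ** (- rmult 1)) ** (- rmult 2)) ** (- rmult 3))"
    by (subst J_op_eq) (intro is_adj_mult is_adj_rmult)
  also have "(((- rmult 0) ** (- rmult 1)) ** (- rmult 2)) ** (- rmult 3) = J_op"
    by (subst J_op_eq_rev) (simp add: matrix_mul_minus matrix_mul_assoc)
  finally show ?thesis .
qed

lemma is_adj_rot: "is_adj (rot \<zeta>) (rot (- \<zeta>))"
proof -
  have "is_adj (rot \<zeta>) (mat (cnj (complex_of_real (cos \<zeta>))) + J_op ** mat (cnj (\<i> * complex_of_real (sin \<zeta>))))"
    unfolding rot_def by (intro is_adj_add is_adj_mult is_adj_mat is_adj_J_op)
  also have "J_op ** mat (cnj (\<i> * complex_of_real (sin \<zeta>))) = mat (\<i> * complex_of_real (sin (- \<zeta>))) ** J_op"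
    by (simp add: mat_mul_commute)
  finally show ?thesis by (simp add: rot_def[of "- \<zeta>"])
qed

text \<open>The adjoint reverses both the angle and the order; commuting the rotation back past
  \<open>rmult a\<close> restores the angle.\<close>

lemma is_adj_theta_op: "is_adj (theta_op \<zeta> a) (- theta_op \<zeta> a)"
  using is_adj_mult[OF is_adj_rot is_adj_rmult, of \<zeta> a]
  by (simp add: theta_op_def rot_rmult matrix_mul_minus)

lemma theta_op_in_commutant: "theta_op \<zeta> a \<in> commutant"
proof -
  have "rot \<zeta> ** gamma b = gamma b ** rot \<zeta>" for b
  proof -
    have J: "mat c ** J_op ** gamma b = gamma b ** (mat c ** J_op)" for c
    proof -
      have "mat c ** J_op ** gamma b = mat c ** gamma b ** J_op"
        using J_op_in_commutant by (simp add: commutant_def flip: matrix_mul_assoc)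
      also have "mat c ** gamma b = gamma b ** mat c"
        by (rule mat_mul_commute)
      finally show ?thesis by (simp only: matrix_mul_assoc)
    qed
    show ?thesis
      by (simp only: rot_def matrix_mul_add matrix_add_ldistrib J mat_mul_commute[of _ "gamma b"])
  qed
  then show ?thesis
    unfolding theta_op_def by (intro mult_in_commutant rmult_in_commutant) (simp add: commutant_def)
qed

text \<open>Two skew-adjoint operators that commute have a self-adjoint product.\<close>

lemma is_adj_gamma_theta_op: "is_adj (gamma a ** theta_op \<zeta> a) (gamma a ** theta_op \<zeta> a)"
  using is_adj_mult[OF is_adj_gamma is_adj_theta_op, of a \<zeta> a] theta_op_in_commutant[of \<zeta> a]
  by (simp add: matrix_mul_minus commutant_def)

lemma sum_eta: "(\<Sum>b\<in>UNIV. eta $ a $ b *\<^sub>R f b) = eta $ a $ a *\<^sub>R (f a :: 'a :: real_vector)"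
proof -
  have "(\<Sum>b\<in>UNIV. eta $ a $ b *\<^sub>R f b) = (\<Sum>b\<in>UNIV. if b = a then eta $ a $ a *\<^sub>R f a else 0)"
    by (rule sum.cong) (auto simp: eta_off)
  then show ?thesis by simp
qed

text \<open>Written exactly as on the right of the field equation, so that it can be folded
  there.\<close>

definition source_vec :: "real \<Rightarrow> multivector \<Rightarrow> multivector" where
  "source_vec \<zeta> v = (\<Sum>\<alpha>\<in>UNIV. gamma_up \<alpha> *v (rot \<zeta> *v (Theta {\<alpha>} *v v)))"

text \<open>The real part loses nothing, by \<open>source_real\<close>, and makes the source a real
  function.\<close>

definition source :: "real \<Rightarrow> multivector \<Rightarrow> real" where
  "source \<zeta> v = Re (hform v (source_vec \<zeta> v))"

lemma is_adj_self_real: "is_adj A A \<Longrightarrow> hform v (A *v v) \<in> \<real>"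
  by (metis hform_cnj is_adj_def Reals_cnj_iff)

lemma hform_sum: "hform w (sum f S) = (\<Sum>i\<in>S. hform w (f i))"
  by (induction S rule: infinite_finite_induct) (auto simp: hform_add, simp_all add: hform_eq)

lemma source_real: "hform v (source_vec \<zeta> v) = complex_of_real (source \<zeta> v)"
proof -
  have "gamma_up \<alpha> *v (rot \<zeta> *v (Theta {\<alpha>} *v v)) = complex_of_real (eta $ \<alpha> $ \<alpha>) *s ((gamma \<alpha> ** theta_op \<zeta> \<alpha>) *v v)" for \<alpha>
    by (simp add: gamma_up_def sum_eta scaleR_mv Theta_singleton theta_op_def matrix_vector_mul_assoc matrix_mul_assoc
        flip: scalar_matrix_assoc)
  then have "hform v (source_vec \<zeta> v) \<in> \<real>"
    unfolding source_vec_def hform_sum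
    by (auto simp: hform_smult intro!: sum_in_Reals Reals_mult is_adj_self_real is_adj_gamma_theta_op)
  then show ?thesis by (simp add: source_def of_real_Re)
qed

section \<open>Smooth bump functions and the fundamental lemma\<close>

lemma smooth_differentiable: "smooth f \<Longrightarrow> f differentiable (at x)"
  by (metis Ck.simps(2) UNIV_I differentiable_on_def smooth_def)

lemma smooth_continuous: "smooth f \<Longrightarrow> continuous_on UNIV f"
  by (metis Ck.simps(1) smooth_def)

lemma smooth_pd: "smooth f \<Longrightarrow> smooth (pd a f)"
  by (metis Ck.simps(2) smooth_def)

lemma pd_eqI: "(f has_derivative D) (at x) \<Longrightarrow> pd a f x = D (axis a 1)"
  unfolding pd_def by (metis frechet_derivative_at)

lemma pd_add:
  assumes "f differentiable (at x)" "g differentiable (at x)"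
  shows "pd a (\<lambda>x. f x + g x) x = pd a f x + pd a g x"
  using pd_eqI[OF has_derivative_add[OF assms[unfolded frechet_derivative_works]]]
  by (simp only: pd_def)

lemma pd_mult:
  fixes f g :: "spacetime \<Rightarrow> real"
  assumes "f differentiable (at x)" "g differentiable (at x)"
  shows "pd a (\<lambda>x. f x * g x) x = f x * pd a g x + pd a f x * g x"
  using pd_eqI[OF has_derivative_mult[OF assms[unfolded frechet_derivative_works]]]
  by (simp only: pd_def)

text \<open>For n = 0 this is the classical function exp(-1/t), extended by 0; the powers of 1/t
  arise on differentiating it.\<close>

definition flat :: "nat \<Rightarrow> real \<Rightarrow> real" where
  "flat n t = (if t > 0 then inverse t ^ n * exp (- inverse t) else 0)"

text \<open>With s = 1/t this is s^(n+1) / e^s for large s. It is the difference quotient at 0 and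
  so gives the derivative there.\<close>

lemma flat_quotient_tendsto_0: "((\<lambda>t. flat n t / t) \<longlongrightarrow> 0) (at 0)"
proof -
  have "((\<lambda>t. inverse t ^ Suc n / exp (inverse t)) \<longlongrightarrow> (0::real)) (at_right 0)"
    by (rule filterlim_compose[OF tendsto_power_div_exp_0 filterlim_inverse_at_top_right])
  moreover have "\<forall>\<^sub>F t in at_right 0. inverse t ^ Suc n / exp (inverse t) = flat n t / t"
    unfolding eventually_at_right_field
    by (intro exI[of _ 1]) (auto simp: flat_def exp_minus field_simps)
  ultimately have "((\<lambda>t. flat n t / t) \<longlongrightarrow> 0) (at_right 0)"
    by (rule Lim_transform_eventually)
  moreover have "\<forall>\<^sub>F t in at_left 0. flat n t / t = 0"
    unfolding eventually_at_left_field by (intro exI[of _ "-1"]) (auto simp: flat_def)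
  then have "((\<lambda>t. flat n t / t) \<longlongrightarrow> 0) (at_left 0)"
    by (rule tendsto_eventually)
  ultimately show ?thesis by (simp add: filterlim_at_split)
qed

lemma flat_has_derivative:
  "(flat n has_real_derivative flat (n + 2) t - of_nat n * flat (n + 1) t) (at t)"
proof (cases t "0 :: real" rule: linorder_cases)
  case less
  have "((\<lambda>t. 0) has_real_derivative 0) (at t)" by simp
  then have "(flat n has_real_derivative 0) (at t)"
    by (rule has_field_derivative_transform_within_open[of _ _ _ "{..<0}"]) (use less in \<open>auto simp: flat_def\<close>)
  then show ?thesis using less by (simp add: flat_def)
next
  case equal
  have "(flat n has_real_derivative 0) (at 0)"
    using flat_quotient_tendsto_0[of n] by (simp add: has_field_derivative_iff flat_def)
  then show ?thesis by (simp add: equal flat_def)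
next
  case greater
  have "((\<lambda>t. inverse t ^ n * exp (- inverse t)) has_real_derivative flat (n + 2) t - of_nat n * flat (n + 1) t) (at t)"
    using greater
    by (cases n) (auto intro!: derivative_eq_intros simp: flat_def algebra_simps,
         metis Suc_pred power_Suc neq0_conv)
  then show ?thesis
    by (rule has_field_derivative_transform_within_open[of _ _ _ "{0<..}"]) (use greater in \<open>auto simp: flat_def\<close>)
qed

text \<open>The derivative of \<^term>\<open>flat n\<close> is a combination of \<^term>\<open>flat (n + 2)\<close> and \<^term>\<open>flat (n + 1)\<close>, so
  the algebra \<open>flat_alg\<close> generated by these functions and the coordinates is closed under partial
  derivatives, and all its members are smooth.\<close>

inductive flat_alg :: "(spacetime \<Rightarrow> real) \<Rightarrow> bool" where
  const: "flat_alg (\<lambda>x. c)"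
| coord: "flat_alg (\<lambda>x. x $ i)"
| add: "flat_alg f \<Longrightarrow> flat_alg g \<Longrightarrow> flat_alg (\<lambda>x. f x + g x)"
| mult: "flat_alg f \<Longrightarrow> flat_alg g \<Longrightarrow> flat_alg (\<lambda>x. f x * g x)"
| flat: "flat_alg f \<Longrightarrow> flat_alg (\<lambda>x. flat n (f x))"

lemma flat_alg_pd:
  assumes "flat_alg f"
  shows "f differentiable (at x)" "flat_alg (pd a f)"
proof -
  have "(\<forall>x. f differentiable (at x)) \<and> flat_alg (pd a f)"
    using assms
  proof induction
    case (const c)
    have "pd a (\<lambda>x. c) = (\<lambda>x. 0)"
      by (rule ext, subst pd_eqI[OF has_derivative_const]) simp
    then show ?case by (auto intro: flat_alg.const)
  next
    case (coord i)
    have der: "((\<lambda>x. x $ i) has_derivative (\<lambda>h. h $ i)) (at x)" for x :: spacetime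
      by (rule bounded_linear_imp_has_derivative) (rule bounded_linear_vec_nth)
    have "pd a (\<lambda>x. x $ i) = (\<lambda>x. axis a 1 $ i)"
      by (rule ext) (simp add: pd_eqI[OF der])
    then show ?case using der by (auto intro: flat_alg.const simp: differentiable_def)
  next
    case (add f g)
    have "pd a (\<lambda>x. f x + g x) = (\<lambda>x. pd a f x + pd a g x)"
      using add by (intro ext) (simp add: pd_add)
    then show ?case using add by (auto intro: flat_alg.add)
  next
    case (mult f g)
    have "pd a (\<lambda>x. f x * g x) = (\<lambda>x. f x * pd a g x + pd a f x * g x)"
      using mult by (intro ext) (simp add: pd_mult)
    then show ?case using mult by (auto intro!: flat_alg.intros)
  next
    case (flat f n)
    define d where "d t = flat (n + 2) t + (- of_nat n) * flat (n + 1) t" for t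
    have der: "((\<lambda>x. flat n (f x)) has_derivative (\<lambda>h. frechet_derivative f (at x) h * d (f x))) (at x)" for x
      using flat by (intro DERIV_compose_FDERIV[OF flat_has_derivative[THEN DERIV_cong]])
        (simp_all add: d_def frechet_derivative_works)
    then have "pd a (\<lambda>x. flat n (f x)) = (\<lambda>x. pd a f x * d (f x))"
      by (intro ext) (simp add: pd_eqI[OF der] pd_def)
    moreover have "flat_alg (\<lambda>x. pd a f x * d (f x))"
      unfolding d_def using flat by (intro flat_alg.intros) auto
    ultimately show ?case using der by (auto simp: differentiable_def)
  qed
  then show "f differentiable (at x)" "flat_alg (pd a f)" by auto
qed

lemma flat_alg_smooth: "flat_alg f \<Longrightarrow> smooth f"
proof -
  have "flat_alg f \<Longrightarrow> Ck k f" for k f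
  proof (induction k arbitrary: f)
    case 0
    then show ?case using flat_alg_pd(1) by (auto intro!: differentiable_imp_continuous_on simp: differentiable_on_def differentiable_at_withinI)
  next
    case (Suc k)
    then show ?case using flat_alg_pd by (auto simp: differentiable_on_def differentiable_at_withinI)
  qed
  then show "flat_alg f \<Longrightarrow> smooth f" by (simp add: smooth_def)
qed

text \<open>The squared norm is a polynomial in the coordinates, which keeps the function in
  \<open>flat_alg\<close>. For r > 0 it is positive exactly on the open ball.\<close>

definition bump :: "spacetime \<Rightarrow> real \<Rightarrow> spacetime \<Rightarrow> real" where
  "bump p r x = flat 0 (r\<^sup>2 - (norm (x - p))\<^sup>2)"

lemma smooth_bump: "smooth (bump p r)"
proof (rule flat_alg_smooth)
  \<comment> \<open>Differences and squares are spelt out as sums and products, the shapes that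
    \<open>flat_alg\<close> admits.\<close>
  have *: "bump p r = (\<lambda>x. flat 0 (r\<^sup>2 + (-1) * (\<Sum>i\<in>UNIV. (x $ i + (- p $ i)) * (x $ i + (- p $ i)))))"
    by (simp add: bump_def norm_eq_sqrt_inner inner_vec_def fun_eq_iff sum_nonneg)
  show "flat_alg (bump p r)"
    unfolding * sum_4 by (intro flat_alg.intros)
qed

lemma bump_nonneg: "0 \<le> bump p r x"
  by (simp add: bump_def flat_def)

lemma bump_centre: "r > 0 \<Longrightarrow> 0 < bump p r p"
  by (simp add: bump_def flat_def)

lemma bump_support:
  assumes "r > 0" "bump p r x \<noteq> 0"
  shows "x \<in> cball p r"
proof (rule ccontr)
  assume "x \<notin> cball p r"
  then have "r\<^sup>2 < (norm (x - p))\<^sup>2"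
    using assms(1) by (intro power_strict_mono) (auto simp: dist_norm norm_minus_commute)
  then show False using assms(2) by (simp add: bump_def flat_def)
qed

text \<open>If E p were nonzero, E would keep its sign near p, and a bump supported there would give
  a continuous integrand of one sign with integral 0 that is nonzero at p.\<close>

lemma fundamental_lemma:
  fixes E :: "spacetime \<Rightarrow> real"
  assumes cont: "continuous_on UNIV E"
    and zero: "\<And>h a b. smooth h \<Longrightarrow> closure {x. h x \<noteq> 0} \<subseteq> cbox a b \<Longrightarrow> integral (cbox a b) (\<lambda>x. h x * E x) = 0"
  shows "E p = 0"
proof (rule ccontr)
  assume ne: "E p \<noteq> 0"
  have "isCont E p" using cont by (simp add: continuous_on_eq_continuous_at)
  then obtain d where d: "d > 0" "\<And>x. dist x p < d \<Longrightarrow> dist (E x) (E p) < \<bar>E p\<bar>"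
    using ne by (metis continuous_at_eps_delta zero_less_abs_iff dist_commute)
  \<comment> \<open>Half the radius puts the closed ball inside the open ball of the continuity
    estimate.\<close>
  define r where "r = d / 2"
  have r: "r > 0" using d by (simp add: r_def)
  have sign: "0 \<le> E x * E p" if "x \<in> cball p r" for x
  proof -
    have "\<bar>E x - E p\<bar> < \<bar>E p\<bar>" using that d r by (auto simp: r_def dist_real_def dist_commute)
    then show ?thesis by (cases "E p > 0") (auto simp: mult_nonneg_nonneg mult_nonpos_nonpos)
  qed
  obtain a b where ab: "cball p r \<subseteq> cbox a b"
    using bounded_subset_cbox_symmetric[OF bounded_cball] by metis
  have "closure {x. bump p r x \<noteq> 0} \<subseteq> cball p r"
    using bump_support[OF r] by (intro closure_minimal subsetI) (simp_all del: mem_cball)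
  then have int0: "integral (cbox a b) (\<lambda>x. bump p r x * E x) = 0"
    by (intro zero smooth_bump order_trans[OF _ ab])
  \<comment> \<open>The factor E p makes the integrand nonnegative whatever the sign of E p.\<close>
  let ?f = "\<lambda>x. bump p r x * E x * E p"
  have contf: "continuous_on (cbox a b) (\<lambda>x. bump p r x * E x)"
    using smooth_continuous[OF smooth_bump] cont by (intro continuous_intros) (auto intro: continuous_on_subset)
  have "((\<lambda>x. bump p r x * E x) has_integral 0) (cbox a b)"
    using integrable_continuous[OF contf] int0 by (metis has_integral_integral)
  from has_integral_mult_left[OF this, of "E p"] have hi: "(?f has_integral 0) (cbox a b)"
    by simp
  have nonneg: "0 \<le> ?f x" for x
  proof (cases "x \<in> cball p r")
    case True
    then show ?thesis using sign bump_nonneg by (simp add: mult.assoc)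
  next
    case False
    then have "bump p r x = 0" using bump_support[OF r] by metis
    then show ?thesis by simp
  qed
  \<comment> \<open>A ball around p inside the box shows that the box is not degenerate.\<close>
  have p: "p \<in> ball p r" "ball p r \<subseteq> cbox a b" using r ab by auto
  then have "p \<in> interior (cbox a b)" by (metis interior_maximal open_ball subsetD)
  then have "p \<in> box a b" by simp
  then have "?f p = 0"
    by (intro has_integral_0_cbox_imp_0[OF _ nonneg hi]) (use contf p in \<open>auto intro!: continuous_intros\<close>)
  then show False using bump_centre[OF r, of p] ne by auto
qed

section \<open>The Lagrangians in terms of the scalar field\<close>

lemma pd_scaleR:
  assumes "f differentiable (at x)"
  shows "pd a (\<lambda>x. f x *\<^sub>R v) x = pd a f x *\<^sub>R v"
  using pd_eqI[OF has_derivative_scaleR_left[OF frechet_derivative_works[THEN iffD1, OF assms]], of a v]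
  by (simp add: pd_def)

lemma Omega_U:
  assumes "\<phi> differentiable (at x)"
  shows "Omega (U \<zeta> \<phi>) a b x = pd a \<phi> x *\<^sub>R theta_op \<zeta> b - pd b \<phi> x *\<^sub>R theta_op \<zeta> a + (\<phi> x)\<^sup>2 *\<^sub>R theta_comm \<zeta> a b"
proof -
  have "U \<zeta> \<phi> c = (\<lambda>x. \<phi> x *\<^sub>R theta_op \<zeta> c)" for c
    by (simp add: U_eq fun_eq_iff)
  then show ?thesis
    by (simp add: Omega_def pd_scaleR[OF assms] theta_comm_def matrix_scalar_ac power2_eq_square
        scaleR_diff_right flip: scalar_matrix_assoc)
qed

lemma Omega_up_eq: "Omega_up \<theta> a b x = (eta $ a $ a * eta $ b $ b) *\<^sub>R Omega \<theta> a b x"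
proof -
  have "Omega_up \<theta> a b x = (\<Sum>\<mu>\<in>UNIV. eta $ a $ \<mu> *\<^sub>R (\<Sum>\<nu>\<in>UNIV. eta $ b $ \<nu> *\<^sub>R Omega \<theta> \<mu> \<nu> x))"
    by (simp add: Omega_up_def scaleR_sum_right)
  then show ?thesis by (simp only: sum_eta) simp
qed

text \<open>W is the curvature for p = d_a phi, q = d_b phi, r = phi^2. The mixed terms are products
  of three Thetas and have trace 0.\<close>

lemma trace_curvature_sq:
  fixes p q r \<zeta> :: real and a b :: 4
  defines "W \<equiv> p *\<^sub>R theta_op \<zeta> b - q *\<^sub>R theta_op \<zeta> a + r *\<^sub>R theta_comm \<zeta> a b"
  shows "trace (W ** W) = complex_of_real (- 16 * cos (2 * \<zeta>) * (p\<^sup>2 * eta $ b $ b + q\<^sup>2 * eta $ a $ a - 2 * p * q * eta $ a $ b)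
    - r\<^sup>2 * (if a = b then 0 else 64 * (cos (2 * \<zeta>))\<^sup>2 * eta $ a $ a * eta $ b $ b))"
  unfolding W_def
  by (simp add: matrix_add_ldistrib matrix_mul_add matrix_mul_diff matrix_scalar_ac trace_add trace_sub trace_scaleR
     trace_theta_op_2 trace_theta_op_comm trace_theta_comm_sq power2_eq_square flip: scalar_matrix_assoc)
   (simp add: algebra_simps eta_def)

lemma trace_sum: "trace (sum f S) = (\<Sum>i\<in>S. trace (f i :: multiop))"
  by (induction S rule: infinite_finite_induct) (auto simp: trace_add, simp_all add: trace_def)

lemma plus_cc_half_of_real: "plus_cc (1/2 * complex_of_real r) = complex_of_real r"
  by (simp add: plus_cc_def)

lemma pd_up_eq: "pd_up a f x = eta $ a $ a *\<^sub>R pd a f x"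
  by (simp add: pd_up_def sum_eta)

lemma L_V_U:
  assumes "\<phi> differentiable (at x)"
  shows "L_V (U \<zeta> \<phi>) x = complex_of_real (- 96 * cos (2 * \<zeta>) *
               ((\<Sum>\<alpha>\<in>UNIV. pd_up \<alpha> \<phi> x * pd \<alpha> \<phi> x) + 8 * cos (2 * \<zeta>) * \<phi> x ^ 4))"
proof -
  define p where "p a = pd a \<phi> x" for a
  define k where "k = cos (2 * \<zeta>)"
  define T where "T a b = eta $ a $ a * eta $ b $ b * (- 16 * k * ((p a)\<^sup>2 * eta $ b $ b + (p b)\<^sup>2 * eta $ a $ a - 2 * p a * p b * eta $ a $ b)
    - (\<phi> x)^4 * (if a = b then 0 else 64 * k\<^sup>2 * eta $ a $ a * eta $ b $ b))" for a b
  have "trace (Omega (U \<zeta> \<phi>) a b x ** Omega_up (U \<zeta> \<phi>) a b x) = complex_of_real (T a b)" for a b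
    unfolding Omega_up_eq matrix_scalar_ac scalar_matrix_assoc[symmetric] trace_scaleR Omega_U[OF assms] trace_curvature_sq
    by (simp add: T_def k_def p_def scaleR_conv_of_real)
  then have "L_V (U \<zeta> \<phi>) x = plus_cc (1/2 * complex_of_real (\<Sum>a\<in>UNIV. \<Sum>b\<in>UNIV. T a b))"
    by (simp add: L_V_def trace_sum)
  \<comment> \<open>With S the squared gradient, the two squares give 4 S each and the mixed term -
    2 S: - 16 * 6 = - 96. The twelve ordered pairs of distinct indices give - 64 * 12 = - 96 *
    8.\<close>
  also have "(\<Sum>a\<in>UNIV. \<Sum>b\<in>UNIV. T a b) = - 96 * k * ((\<Sum>\<alpha>\<in>UNIV. pd_up \<alpha> \<phi> x * pd \<alpha> \<phi> x) + 8 * k * \<phi> x ^ 4)"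
    by (simp add: T_def sum_4 pd_up_eq eta_def flip: p_def) (simp add: algebra_simps power2_eq_square)
  finally show ?thesis by (simp only: plus_cc_half_of_real k_def)
qed

lemma hform_scaleR: "hform w (c *\<^sub>R u) = c *\<^sub>R hform w u"
  by (simp add: hform_eq scaleR_sum_right)

lemma mv_scaleR: "A *v (c *\<^sub>R v) = c *\<^sub>R (A *v v)" for A :: multiop
  by (simp add: vec_eq_iff matrix_vector_mult_def scaleR_sum_right)

lemma Dirac_U: "Dirac (U \<zeta> \<phi>) \<psi> x = (\<Sum>\<alpha>\<in>UNIV. gamma_up \<alpha> *v pd \<alpha> \<psi> x) + \<phi> x *\<^sub>R source_vec \<zeta> (\<psi> x)"
proof -
  have "U \<zeta> \<phi> \<alpha> x *v v = \<phi> x *\<^sub>R (rot \<zeta> *v (Theta {\<alpha>} *v v))" for \<alpha> v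
    by (simp add: U_eq theta_op_def Theta_singleton matrix_vector_mul_assoc) (simp add: vec_eq_iff matrix_vector_mult_def scaleR_sum_right)
  then show ?thesis
    by (simp add: Dirac_def source_vec_def matrix_vector_right_distrib sum.distrib mv_scaleR scaleR_sum_right)
qed

definition L_K_free :: "real \<Rightarrow> (spacetime \<Rightarrow> multivector) \<Rightarrow> spacetime \<Rightarrow> complex" where
  "L_K_free m \<psi> x = plus_cc (1/2 * hform (\<psi> x) (\<Sum>\<alpha>\<in>UNIV. gamma_up \<alpha> *v pd \<alpha> \<psi> x))
     - complex_of_real m * hform (\<psi> x) (\<psi> x)"

text \<open>The source is real, so adding the complex conjugate restores the half of the interaction
  term.\<close>

lemma L_K_U: "L_K m (U \<zeta> \<phi>) \<psi> x = L_K_free m \<psi> x + complex_of_real (\<phi> x * source \<zeta> (\<psi> x))"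
  unfolding L_K_def L_K_free_def hform_def[symmetric] Dirac_U hform_add hform_scaleR source_real
  by (simp add: plus_cc_def scaleR_conv_of_real[where 'a = complex] field_simps)

section \<open>Variation of the action\<close>

lemma pd_eq_0_outside:
  fixes F :: "spacetime \<Rightarrow> real"
  assumes "\<And>x. x \<notin> cbox a b \<Longrightarrow> F x = 0" and "x \<notin> cbox a b"
  shows "pd i F x = 0"
proof -
  have "(F has_derivative (\<lambda>h. 0)) (at x)"
    by (rule has_derivative_transform_within_open[OF has_derivative_const, of "- cbox a b"])
      (use assms in \<open>auto simp: open_Compl\<close>)
  from pd_eqI[OF this] show ?thesis .
qed

text \<open>By translation invariance the integral of F(x + t e) over a larger box does not depend
  on small t; differentiating under the integral at t = 0 gives the claim.\<close>

lemma integral_pd_eq_0: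
  fixes F :: "spacetime \<Rightarrow> real"
  assumes diff: "\<And>x. F differentiable (at x)"
    and cont: "continuous_on UNIV (pd i F)"
    and supp: "\<And>x. x \<notin> cbox a b \<Longrightarrow> F x = 0"
  shows "integral (cbox a b) (pd i F) = 0"
proof -
  define e :: spacetime where "e = axis i 1"
  have contF: "continuous_on UNIV F"
    using diff by (simp add: continuous_on_eq_continuous_at differentiable_imp_continuous_within)
  \<comment> \<open>Here 1 is the all-ones vector: one unit of room on every side suffices for
    shifts with t in [-1, 1].\<close>
  have sub: "(\<lambda>x. x - t *\<^sub>R e) ` cbox a b \<subseteq> cbox (a - 1) (b + 1)" if "t \<in> {-1..1}" for t
    using that by (auto simp: mem_box_cart e_def axis_def) (smt (verit, best))+
  have shift: "((\<lambda>x. F (x + t *\<^sub>R e)) has_integral integral (cbox a b) F) (cbox (a - 1) (b + 1))"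
    if t: "t \<in> {-1..1}" for t
  proof (rule has_integral_on_superset[OF _ _ sub[OF t]])
    have "(F has_integral integral (cbox a b) F) (cbox a b)"
      using integrable_continuous[of a b F] continuous_on_subset[OF contF] by (simp add: integrable_integral)
    from has_integral_affinity[OF this, of 1 "t *\<^sub>R e"]
    show "((\<lambda>x. F (x + t *\<^sub>R e)) has_integral integral (cbox a b) F) ((\<lambda>x. x - t *\<^sub>R e) ` cbox a b)"
      by simp
    fix x assume "x \<notin> (\<lambda>x. x - t *\<^sub>R e) ` cbox a b"
    then have "x + t *\<^sub>R e \<notin> cbox a b" by (metis add_diff_cancel image_eqI)
    then show "F (x + t *\<^sub>R e) = 0" by (rule supp)
  qed
  have "((\<lambda>t. integral (cbox (a - 1) (b + 1)) (\<lambda>x. F (x + t *\<^sub>R e))) has_vector_derivative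
      integral (cbox (a - 1) (b + 1)) (\<lambda>x. pd i F (x + 0 *\<^sub>R e))) (at 0 within {-1..1})"
  proof (rule leibniz_rule_vector_derivative)
    fix t :: real and x :: spacetime
    have "((\<lambda>t. x + t *\<^sub>R e) has_derivative (\<lambda>t. t *\<^sub>R e)) (at t within {-1..1})"
      by (auto intro!: derivative_eq_intros)
    from has_derivative_compose[OF this diff[unfolded frechet_derivative_works]]
    have "((\<lambda>t. F (x + t *\<^sub>R e)) has_derivative (\<lambda>s. frechet_derivative F (at (x + t *\<^sub>R e)) (s *\<^sub>R e))) (at t within {-1..1})" .
    moreover have "frechet_derivative F (at (x + t *\<^sub>R e)) (s *\<^sub>R e) = s *\<^sub>R pd i F (x + t *\<^sub>R e)" for s
      using linear_frechet_derivative[OF diff] by (simp add: linear_cmul pd_def e_def)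
    ultimately show "((\<lambda>t. F (x + t *\<^sub>R e)) has_vector_derivative pd i F (x + t *\<^sub>R e)) (at t within {-1..1})"
      by (simp add: has_vector_derivative_def)
  next
    show "continuous_on ({-1..1} \<times> cbox (a - 1) (b + 1)) (\<lambda>(t, x). pd i F (x + t *\<^sub>R e))"
      unfolding case_prod_unfold
      by (rule continuous_on_compose2[OF cont]) (auto intro!: continuous_intros)
  qed (use shift in \<open>auto simp: has_integral_iff\<close>)
  \<comment> \<open>The same function of t is constant by \<open>shift\<close>.\<close>
  moreover have "((\<lambda>t. integral (cbox (a - 1) (b + 1)) (\<lambda>x. F (x + t *\<^sub>R e))) has_vector_derivative 0) (at 0 within {-1..1})"
    by (rule has_vector_derivative_transform[where f="\<lambda>t. integral (cbox a b) F"])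
      (use shift in \<open>auto simp: has_integral_iff\<close>)
  ultimately have "integral (cbox (a - 1) (b + 1)) (pd i F) = 0"
    using vector_derivative_unique_within[of "0::real" "{-1..1}"] by (auto simp: trivial_limit_within islimpt_Icc)
  \<comment> \<open>The derivative vanishes off the smaller box, so the two boxes give the same
    integral.\<close>
  moreover have "(pd i F has_integral integral (cbox a b) (pd i F)) (cbox (a - 1) (b + 1))"
  proof (rule has_integral_on_superset)
    show "(pd i F has_integral integral (cbox a b) (pd i F)) (cbox a b)"
      using integrable_continuous[of a b "pd i F"] continuous_on_subset[OF cont] by (simp add: integrable_integral)
    show "cbox a b \<subseteq> cbox (a - 1) (b + 1)"
      using sub[of 0] by simp
  qed (rule pd_eq_0_outside[OF supp])
  ultimately show ?thesis by (simp add: has_integral_iff)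
qed

text \<open>Integrating coefficient by coefficient gives a polynomial in \<epsilon>, so no limit has
  to be exchanged with the integral.\<close>

lemma has_vector_derivative_integral_polynomial:
  fixes A0 :: "spacetime \<Rightarrow> complex" and A1 A2 A3 A4 :: "spacetime \<Rightarrow> real"
  assumes "continuous_on UNIV A0" "continuous_on UNIV A1" "continuous_on UNIV A2"
    "continuous_on UNIV A3" "continuous_on UNIV A4"
  shows "((\<lambda>\<epsilon>. integral (cbox a b) (\<lambda>x. A0 x + complex_of_real (\<epsilon> * A1 x + \<epsilon>^2 * A2 x + \<epsilon>^3 * A3 x + \<epsilon>^4 * A4 x)))
     has_vector_derivative complex_of_real (integral (cbox a b) A1)) (at 0)"
proof -
  define I where "I A = integral (cbox a b) A" for A :: "spacetime \<Rightarrow> real"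
  have hi: "(A has_integral I A) (cbox a b)" if "continuous_on UNIV A" for A
    using integrable_continuous[OF continuous_on_subset[OF that]] by (simp add: I_def integrable_integral)
  have hi0: "(A0 has_integral integral (cbox a b) A0) (cbox a b)"
    using integrable_continuous[OF continuous_on_subset[OF assms(1)]] by (simp add: integrable_integral)
  have "((\<lambda>x. A0 x + complex_of_real (\<epsilon> * A1 x + \<epsilon>^2 * A2 x + \<epsilon>^3 * A3 x + \<epsilon>^4 * A4 x)) has_integral
     integral (cbox a b) A0 + complex_of_real (\<epsilon> * I A1 + \<epsilon>^2 * I A2 + \<epsilon>^3 * I A3 + \<epsilon>^4 * I A4)) (cbox a b)" for \<epsilon>
    using hi[OF assms(2)] hi[OF assms(3)] hi[OF assms(4)] hi[OF assms(5)]
    by (intro has_integral_add[OF hi0] has_integral_linear[OF _ bounded_linear_of_real, unfolded o_def] has_integral_add has_integral_mult_right)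
  then have eq: "integral (cbox a b) (\<lambda>x. A0 x + complex_of_real (\<epsilon> * A1 x + \<epsilon>^2 * A2 x + \<epsilon>^3 * A3 x + \<epsilon>^4 * A4 x))
     = integral (cbox a b) A0 + complex_of_real (\<epsilon> * I A1 + \<epsilon>^2 * I A2 + \<epsilon>^3 * I A3 + \<epsilon>^4 * I A4)" for \<epsilon>
    by (rule integral_unique)
  have "((\<lambda>\<epsilon>. \<epsilon> * I A1 + \<epsilon>^2 * I A2 + \<epsilon>^3 * I A3 + \<epsilon>^4 * I A4) has_vector_derivative I A1) (at 0)"
    unfolding has_real_derivative_iff_has_vector_derivative[symmetric]
    by (auto intro!: derivative_eq_intros)
  then have "((\<lambda>\<epsilon>. complex_of_real (\<epsilon> * I A1 + \<epsilon>^2 * I A2 + \<epsilon>^3 * I A3 + \<epsilon>^4 * I A4)) has_vector_derivative complex_of_real (I A1)) (at 0)"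
    by (rule bounded_linear.has_vector_derivative[OF bounded_linear_of_real])
  from has_vector_derivative_add[OF has_vector_derivative_const this]
  show ?thesis unfolding eq by (simp add: I_def)
qed

lemma continuous_on_mv: "continuous_on S f \<Longrightarrow> continuous_on S (\<lambda>x. A *v f x)" for A :: multiop
  by (rule bounded_linear.continuous_on[OF matrix_vector_mul_bounded_linear])

lemma continuous_on_hform: "continuous_on S f \<Longrightarrow> continuous_on S g \<Longrightarrow> continuous_on S (\<lambda>x. hform (f x) (g x))"
  unfolding hform_eq by (intro continuous_intros)

lemma continuous_on_source: "continuous_on S f \<Longrightarrow> continuous_on S (\<lambda>x. source \<zeta> (f x))"
  unfolding source_def source_vec_def
  by (intro continuous_intros continuous_on_hform continuous_on_mv)

lemma continuous_on_L_K_free: "smooth \<psi> \<Longrightarrow> continuous_on UNIV (L_K_free m \<psi>)"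
  unfolding L_K_free_def[abs_def] plus_cc_def
  by (intro continuous_intros continuous_on_hform continuous_on_mv smooth_continuous smooth_pd)

lemma pd_cmult:
  fixes f :: "spacetime \<Rightarrow> real"
  assumes "f differentiable (at x)"
  shows "pd a (\<lambda>x. c * f x) x = c * pd a f x"
  using pd_eqI[OF has_derivative_mult_right[OF assms[unfolded frechet_derivative_works]]]
  by (simp only: pd_def)

text \<open>The variational derivative: 32 = 8 * 4 comes from the quartic term, and - 2 from the
  squared gradient after integration by parts.\<close>

definition euler_lagrange :: "real \<Rightarrow> real \<Rightarrow> (spacetime \<Rightarrow> real) \<Rightarrow> (spacetime \<Rightarrow> multivector) \<Rightarrow> spacetime \<Rightarrow> real" where
  "euler_lagrange \<zeta> \<tau> \<phi> \<psi> x = source \<zeta> (\<psi> x) +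
     96 * \<tau> * cos (2 * \<zeta>) * (32 * cos (2 * \<zeta>) * \<phi> x ^ 3 - 2 * (\<Sum>\<alpha>\<in>UNIV. pd \<alpha> (pd_up \<alpha> \<phi>) x))"

lemma pd_pd_up:
  fixes \<phi> :: "spacetime \<Rightarrow> real"
  assumes "smooth \<phi>"
  shows "pd a (pd_up a \<phi>) x = eta $ a $ a * pd a (pd a \<phi>) x"
proof -
  have "pd_up a \<phi> = (\<lambda>x. eta $ a $ a * pd a \<phi> x)"
    by (simp add: pd_up_eq fun_eq_iff)
  then show ?thesis
    using assms by (simp add: pd_cmult smooth_differentiable smooth_pd)
qed

lemma continuous_on_euler_lagrange:
  assumes "smooth \<phi>" "smooth \<psi>"
  shows "continuous_on UNIV (euler_lagrange \<zeta> \<tau> \<phi> \<psi>)"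
  unfolding euler_lagrange_def[abs_def] pd_pd_up[OF assms(1)] using assms
  by (intro continuous_intros continuous_on_source smooth_continuous smooth_pd)

lemma action_has_derivative:
  fixes \<phi> h :: "spacetime \<Rightarrow> real"
  assumes \<phi>: "smooth \<phi>" and \<psi>: "smooth \<psi>" and h: "smooth h"
    and supp: "\<And>x. x \<notin> cbox a b \<Longrightarrow> h x = 0"
  shows "((\<lambda>\<epsilon>. integral (cbox a b) (\<lambda>x. L_K m (U \<zeta> (\<lambda>x. \<phi> x + \<epsilon> * h x)) \<psi> x
             - complex_of_real \<tau> * L_V (U \<zeta> (\<lambda>x. \<phi> x + \<epsilon> * h x)) x))
      has_vector_derivative complex_of_real (integral (cbox a b) (\<lambda>x. h x * euler_lagrange \<zeta> \<tau> \<phi> \<psi> x))) (at 0)"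
proof -
  define c where "c = cos (2 * \<zeta>)"
  define \<kappa> where "\<kappa> = 96 * \<tau> * c"
  define s where "s x = source \<zeta> (\<psi> x)" for x
  \<comment> \<open>\<open>A0\<close> to \<open>A4\<close> are the coefficients of the powers of
    \<epsilon>; 32, 48, 32, 8 are 8 times the binomial coefficients 4, 6, 4, 1, and \<kappa> is the
    prefactor of - \<tau> \<open>L_V\<close>.\<close>
  define A0 where "A0 x = L_K_free m \<psi> x +
    complex_of_real (\<phi> x * s x + \<kappa> * ((\<Sum>i\<in>UNIV. eta $ i $ i * (pd i \<phi> x * pd i \<phi> x)) + 8 * c * \<phi> x ^ 4))" for x
  define A1 where "A1 x = h x * s x + \<kappa> * (2 * (\<Sum>i\<in>UNIV. eta $ i $ i * (pd i \<phi> x * pd i h x)) + 32 * c * (\<phi> x ^ 3 * h x))" for x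
  define A2 where "A2 x = \<kappa> * ((\<Sum>i\<in>UNIV. eta $ i $ i * (pd i h x * pd i h x)) + 48 * c * (\<phi> x ^ 2 * h x ^ 2))" for x
  define A3 where "A3 x = \<kappa> * (32 * c * (\<phi> x * h x ^ 3))" for x
  define A4 where "A4 x = \<kappa> * (8 * c * h x ^ 4)" for x
  note dif = smooth_differentiable[OF \<phi>] smooth_differentiable[OF h]
  have L: "L_K m (U \<zeta> (\<lambda>x. \<phi> x + \<epsilon> * h x)) \<psi> x - complex_of_real \<tau> * L_V (U \<zeta> (\<lambda>x. \<phi> x + \<epsilon> * h x)) x
    = A0 x + complex_of_real (\<epsilon> * A1 x + \<epsilon>^2 * A2 x + \<epsilon>^3 * A3 x + \<epsilon>^4 * A4 x)" for \<epsilon> x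
  proof -
    define P where "P i = pd i \<phi> x" for i
    define Q where "Q i = pd i h x" for i
    have diff: "(\<lambda>x. \<phi> x + \<epsilon> * h x) differentiable (at x)"
      using dif by simp
    have "pd i (\<lambda>x. \<phi> x + \<epsilon> * h x) x = P i + \<epsilon> * Q i" for i
      using dif by (simp add: pd_add pd_cmult P_def Q_def)
    then have sq: "(\<Sum>\<alpha>\<in>UNIV. pd_up \<alpha> (\<lambda>x. \<phi> x + \<epsilon> * h x) x * pd \<alpha> (\<lambda>x. \<phi> x + \<epsilon> * h x) x) =
       (\<Sum>i\<in>UNIV. eta $ i $ i * (P i * P i)) + \<epsilon> * (2 * (\<Sum>i\<in>UNIV. eta $ i $ i * (P i * Q i)))
        + \<epsilon>^2 * (\<Sum>i\<in>UNIV. eta $ i $ i * (Q i * Q i))"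
      by (simp add: pd_up_eq sum_distrib_left power2_eq_square algebra_simps flip: sum.distrib)
    have quartic: "(\<phi> x + \<epsilon> * h x) ^ 4 = \<phi> x ^ 4 + \<epsilon> * (4 * (\<phi> x ^ 3 * h x)) + \<epsilon>^2 * (6 * (\<phi> x ^ 2 * h x ^ 2))
        + \<epsilon>^3 * (4 * (\<phi> x * h x ^ 3)) + \<epsilon>^4 * h x ^ 4"
      by (simp add: power4_eq_xxxx power3_eq_cube power2_eq_square algebra_simps)
    have "L_K m (U \<zeta> (\<lambda>x. \<phi> x + \<epsilon> * h x)) \<psi> x - complex_of_real \<tau> * L_V (U \<zeta> (\<lambda>x. \<phi> x + \<epsilon> * h x)) x
     = L_K_free m \<psi> x + complex_of_real ((\<phi> x + \<epsilon> * h x) * s x + \<kappa> *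
         ((\<Sum>\<alpha>\<in>UNIV. pd_up \<alpha> (\<lambda>x. \<phi> x + \<epsilon> * h x) x * pd \<alpha> (\<lambda>x. \<phi> x + \<epsilon> * h x) x) + 8 * c * (\<phi> x + \<epsilon> * h x) ^ 4))"
      unfolding L_K_U L_V_U[OF diff] by (simp add: s_def \<kappa>_def c_def)
    also have "\<dots> = A0 x + complex_of_real (\<epsilon> * A1 x + \<epsilon>^2 * A2 x + \<epsilon>^3 * A3 x + \<epsilon>^4 * A4 x)"
      unfolding sq quartic A0_def A1_def A2_def A3_def A4_def P_def[symmetric] Q_def[symmetric] add.assoc
        of_real_add[symmetric] add_left_cancel of_real_eq_iff
      by (simp add: algebra_simps)
    finally show ?thesis .
  qed
  have cont: "continuous_on UNIV s" "continuous_on UNIV \<phi>" "continuous_on UNIV h"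
    "continuous_on UNIV (pd i \<phi>)" "continuous_on UNIV (pd i h)" "continuous_on UNIV (pd i (pd j \<phi>))"
    "continuous_on UNIV (L_K_free m \<psi>)" for i j
    using assms unfolding s_def by (simp_all add: continuous_on_source continuous_on_L_K_free smooth_continuous smooth_pd)
  have deriv: "((\<lambda>\<epsilon>. integral (cbox a b) (\<lambda>x. A0 x + complex_of_real (\<epsilon> * A1 x + \<epsilon>^2 * A2 x + \<epsilon>^3 * A3 x + \<epsilon>^4 * A4 x)))
     has_vector_derivative complex_of_real (integral (cbox a b) A1)) (at 0)"
    by (rule has_vector_derivative_integral_polynomial;
      unfold A0_def[abs_def] A1_def[abs_def] A2_def[abs_def] A3_def[abs_def] A4_def[abs_def]; intro continuous_intros cont)
  let ?E = "euler_lagrange \<zeta> \<tau> \<phi> \<psi>"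
  let ?D = "\<lambda>i. pd i (\<lambda>x. pd i \<phi> x * h x)"
  have D: "?D i x = pd i \<phi> x * pd i h x + pd i (pd i \<phi>) x * h x" for i x
    using smooth_differentiable[OF smooth_pd[OF \<phi>]] dif(2) by (rule pd_mult)
  \<comment> \<open>The product rule moves the derivative from h to \<open>pd i \<phi>\<close>, at
    the cost of a divergence.\<close>
  have A1: "A1 x = h x * ?E x + 2 * \<kappa> * (\<Sum>i\<in>UNIV. eta $ i $ i * ?D i x)" for x
    unfolding D by (simp add: A1_def euler_lagrange_def pd_pd_up[OF \<phi>] s_def \<kappa>_def c_def sum.distrib algebra_simps sum_distrib_left)
  have contE: "continuous_on (cbox a b) (\<lambda>x. h x * ?E x)"
    by (rule continuous_on_subset[of UNIV]) (intro continuous_intros cont continuous_on_euler_lagrange \<phi> \<psi>, simp)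
  have contD: "continuous_on UNIV (?D i)" for i
    unfolding D by (intro continuous_intros cont)
  \<comment> \<open>h vanishes outside the box, so the divergence integrates to 0.\<close>
  have "(?D i has_integral 0) (cbox a b)" for i
  proof -
    have "integral (cbox a b) (?D i) = 0"
    proof (rule integral_pd_eq_0[OF _ contD])
      show "(\<lambda>x. pd i \<phi> x * h x) differentiable (at x)" for x
        using smooth_differentiable[OF smooth_pd[OF \<phi>]] dif(2) by (rule differentiable_mult)
    qed (simp add: supp)
    moreover have "?D i integrable_on cbox a b"
      by (rule integrable_continuous[OF continuous_on_subset[OF contD]]) simp
    ultimately show ?thesis by (metis has_integral_integral)
  qed
  then have "(A1 has_integral integral (cbox a b) (\<lambda>x. h x * ?E x) + 2 * \<kappa> * (\<Sum>i\<in>UNIV. eta $ i $ i * 0)) (cbox a b)"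
    unfolding A1[abs_def]
    by (intro has_integral_add has_integral_mult_right has_integral_sum integrable_integral integrable_continuous contE) simp_all
  then have "integral (cbox a b) A1 = integral (cbox a b) (\<lambda>x. h x * ?E x)"
    by (simp add: integral_unique)
  with deriv show ?thesis unfolding L by simp
qed

text \<open>The action is always differentiable at \<epsilon> = 0, so by uniqueness of derivatives
  stationarity says that the integral of h times the variational derivative vanishes for every
  h.\<close>

lemma stationary_iff_euler_lagrange:
  assumes \<phi>: "smooth \<phi>" and \<psi>: "smooth \<psi>"
  shows "stationary (\<lambda>\<phi>' x. L_K m (U \<zeta> \<phi>') \<psi> x - complex_of_real \<tau> * L_V (U \<zeta> \<phi>') x) \<phi> \<longleftrightarrow>
    (\<forall>x. euler_lagrange \<zeta> \<tau> \<phi> \<psi> x = 0)"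
proof -
  let ?E = "euler_lagrange \<zeta> \<tau> \<phi> \<psi>"
  have deriv: "((\<lambda>\<epsilon>. integral (cbox a b) (\<lambda>x. L_K m (U \<zeta> (\<lambda>x. \<phi> x + \<epsilon> * h x)) \<psi> x
             - complex_of_real \<tau> * L_V (U \<zeta> (\<lambda>x. \<phi> x + \<epsilon> * h x)) x))
      has_vector_derivative complex_of_real (integral (cbox a b) (\<lambda>x. h x * ?E x))) (at 0)"
    if h: "smooth h" "closure {x. h x \<noteq> 0} \<subseteq> cbox a b" for h a b
  proof (rule action_has_derivative[OF \<phi> \<psi> h(1)])
    show "h x = 0" if "x \<notin> cbox a b" for x
      using h(2) that closure_subset[of "{x. h x \<noteq> 0}"] by (metis (mono_tags, lifting) mem_Collect_eq subsetD)
  qed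
  have "stationary (\<lambda>\<phi>' x. L_K m (U \<zeta> \<phi>') \<psi> x - complex_of_real \<tau> * L_V (U \<zeta> \<phi>') x) \<phi> \<longleftrightarrow>
    (\<forall>h a b. smooth h \<and> closure {x. h x \<noteq> 0} \<subseteq> cbox a b \<longrightarrow> integral (cbox a b) (\<lambda>x. h x * ?E x) = 0)"
    unfolding stationary_def
  proof (intro all_cong1 imp_cong refl)
    fix h :: "spacetime \<Rightarrow> real" and a b
    assume h: "smooth h \<and> closure {x. h x \<noteq> 0} \<subseteq> cbox a b"
    show "((\<lambda>\<epsilon>. integral (cbox a b) (\<lambda>x. L_K m (U \<zeta> (\<lambda>x. \<phi> x + \<epsilon> * h x)) \<psi> x
             - complex_of_real \<tau> * L_V (U \<zeta> (\<lambda>x. \<phi> x + \<epsilon> * h x)) x)) has_vector_derivative 0) (at 0) \<longleftrightarrow>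
        integral (cbox a b) (\<lambda>x. h x * ?E x) = 0"
      (is "(?S has_vector_derivative 0) _ \<longleftrightarrow> ?I = 0")
    proof
      have d: "(?S has_vector_derivative complex_of_real ?I) (at 0)"
        using h by (intro deriv) auto
      show "?I = 0" if "(?S has_vector_derivative 0) (at 0)"
        using vector_derivative_unique_at[OF that d] by simp
      show "(?S has_vector_derivative 0) (at 0)" if "?I = 0"
        using d unfolding that by simp
    qed
  qed
  also have "\<dots> \<longleftrightarrow> (\<forall>x. ?E x = 0)"
    using fundamental_lemma[OF continuous_on_euler_lagrange[OF \<phi> \<psi>]] by auto
  finally show ?thesis .
qed

theorem mainTheorem5:
  fixes \<phi> :: "spacetime \<Rightarrow> real" and \<psi> :: "spacetime \<Rightarrow> multivector"
    and \<zeta> \<tau> m :: real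
  assumes "smooth \<phi>" and "smooth \<psi>"
  shows "(\<forall>x. L_V (U \<zeta> \<phi>) x =
             complex_of_real (- 96 * cos (2 * \<zeta>) *
               ((\<Sum>\<alpha>\<in>UNIV. pd_up \<alpha> \<phi> x * pd \<alpha> \<phi> x) + 8 * cos (2 * \<zeta>) * \<phi> x ^ 4)))
       \<and> (\<tau> \<noteq> 0 \<and> cos (2 * \<zeta>) \<noteq> 0 \<longrightarrow>
           (stationary (\<lambda>\<phi>' x. L_K m (U \<zeta> \<phi>') \<psi> x - complex_of_real \<tau> * L_V (U \<zeta> \<phi>') x) \<phi> \<longleftrightarrow>
            (\<forall>x. complex_of_real ((\<Sum>\<alpha>\<in>UNIV. pd \<alpha> (pd_up \<alpha> \<phi>) x) - 16 * cos (2 * \<zeta>) * \<phi> x ^ 3) =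
                 complex_of_real (1 / (192 * \<tau> * cos (2 * \<zeta>))) *
                   dagger_mult (\<psi> x)
                     (etahat *v (\<Sum>\<alpha>\<in>UNIV. gamma_up \<alpha> *v (rot \<zeta> *v (Theta {\<alpha>} *v \<psi> x)))))))"
proof (intro conjI impI allI)
  show "L_V (U \<zeta> \<phi>) x = complex_of_real (- 96 * cos (2 * \<zeta>) *
               ((\<Sum>\<alpha>\<in>UNIV. pd_up \<alpha> \<phi> x * pd \<alpha> \<phi> x) + 8 * cos (2 * \<zeta>) * \<phi> x ^ 4))" for x
    by (rule L_V_U[OF smooth_differentiable[OF assms(1)]])
  assume nz: "\<tau> \<noteq> 0 \<and> cos (2 * \<zeta>) \<noteq> 0"
  show "stationary (\<lambda>\<phi>' x. L_K m (U \<zeta> \<phi>') \<psi> x - complex_of_real \<tau> * L_V (U \<zeta> \<phi>') x) \<phi> \<longleftrightarrow>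
            (\<forall>x. complex_of_real ((\<Sum>\<alpha>\<in>UNIV. pd \<alpha> (pd_up \<alpha> \<phi>) x) - 16 * cos (2 * \<zeta>) * \<phi> x ^ 3) =
                 complex_of_real (1 / (192 * \<tau> * cos (2 * \<zeta>))) *
                   dagger_mult (\<psi> x)
                     (etahat *v (\<Sum>\<alpha>\<in>UNIV. gamma_up \<alpha> *v (rot \<zeta> *v (Theta {\<alpha>} *v \<psi> x)))))"
    \<comment> \<open>Reality of the source turns the complex field equation into a real one; it
      remains to divide by 192 \<tau> cos 2 zeta, which is nonzero.\<close>
    unfolding stationary_iff_euler_lagrange[OF assms] hform_def[symmetric] source_vec_def[symmetric]
      source_real of_real_mult[symmetric] of_real_eq_iff
    using nz by (intro all_cong1) (auto simp: euler_lagrange_def field_simps)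
qed

end
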